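(* Let $\Lambda$ be a $k$-graph with $1$-skeleton $E$, set of commuting squares $S$, augmented graph $E^+$ and cancellation relations $C$. Let $\mathcal G(\Lambda)$ be the fundamental groupoid of $\Lambda$ with canonical functor $i\colon\Lambda\to\mathcal G(\Lambda)$, and let $\Delta\colon E^+\to\mathcal P(E^+)/(C\cup S)$ be the canonical diagram of type $E^+$ satisfying $C\cup S$. Then there is a unique isomorphism $T\colon\mathcal G(\Lambda)\to\mathcal P(E^+)/(C\cup S)$ such that $T\circ i|_E=\Delta|_E$, where $i|_E$ is the restriction of $i$ to the vertices and edges of $E$ and $\Delta|_E$ is the restriction of $\Delta$ to the subgraph $E\subseteq E^+$.
   Context: Conventions for a small category $\mathbb C$: objects are identified with identity morphisms; $s(a)$, $r(a)$ denote domain (source) and codomain (range); composition is juxtaposition, $ab=a\circ b$ when $s(a)=r(b)$. A $k$-graph is a countable small category $\Lambda$ with a functor $d\colon\Lambda\to\mathbb N^k$ such that for all $\alpha\in\Lambda$ and $n,l\in\mathbb N^k$ with $d(\alpha)=n+l$ there are unique $\beta,\gamma$ with $d(\beta)=n$, $d(\gamma)=l$, $\alpha=\beta\gamma$. Write $\Lambda^0$ for objects, $\Lambda^n=d^{-1}(n)$, and $n_1,\dots,n_k$ for the standard basis of $\mathbb N^k$. The fundamental groupoid $\mathcal G(\Lambda)$ is the category of fractions $\Lambda[\Lambda^{-1}]$ together with the canonical functor $i\colon\Lambda\to\mathcal G(\Lambda)$: it is characterized (up to isomorphism) by $i(a)$ being invertible for all $a\in\Lambda$ and the universal property that every functor $F$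 from $\Lambda$ to a category in which all $F(a)$ are invertible factors uniquely as $F=F'\circ i$; it is a groupoid with the same objects as $\Lambda$, $i$ being the identity on objects. A graph $E=(E^0,E^1,r,s)$; a diagram of type $E$ in a category is a graph morphism into its underlying graph. $\mathcal P(E)$ is the path category (free category) on $E$, paths $e_1\cdots e_m$ written in composition order ($s(e_i)=r(e_{i+1})$). A relation for $E$ is a pair $(\alpha,\beta)$ of paths with common source and range; a diagram satisfies it if it sends $\alpha,\beta$ to the same morphism. For a set $K$ of relations, $\mathcal P(E)/K$ is the quotient of $\mathcal P(E)$ by the smallest equivalence relation containing $K$ compatible with composition (objects identified with $E^0$), and $\Delta\colon E\hookrightarrow\mathcal P(E)\to\mathcal P(E)/K$ is the canonical diagram of type $E$ satisfying $K$. The $1$-skeleton of $\Lambda$ is the graph $E$ with $E^0=\Lambda^0$, $E^1=\bigcup_{i=1}^k\Lambda^{n_i}$, range and source inherited from $\Lambda$. For composable $e,f\in E^1$ ($s(e)=r(f)$) with $d(e)\ne d(f)$ there are unique edges $g,h$ with $ef=gh$ in $\Lambda$, $d(g)=d(f)$, $d(h)=d(e)$; the relation $(ef,gh)$ is a commuting square, and $S$ is the set of all of them (regarded as relations for $E^+$). The augmented graph $E^+$ has vertex set $E^0$ and edge set $E^1\cup E^{-1}$, where $E^{-1}=\{e^{-1}: e\in E^1\}$ is a set of new edges with $s(e^{-1})=r(e)$, $r(e^{-1})=s(e)$; set $(e^{-1})^{-1}=e$. The cancellation relations are $C=\{(e^{-1}e,\,s(e)) : e\in E^1\cup E^{-1}\}$,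 where $s(e)$ denotes the empty path at $s(e)$. *)

theory Defs
  imports "HOL-Library.FuncSet" "HOL-Library.Countable_Set" "HOL-Library.Function_Algebras"
begin

section \<open>Categories and functors\<close>

text \<open>
  Categories are single-sorted: objects are identified with their identity morphisms, so
  domain and codomain are again morphisms. \<open>Comp C a b\<close> is \<open>a \<circ> b\<close>, meaningful when
  \<open>Dom C a = Cod C b\<close>.
\<close>

record 'a cat =
  Arr :: "'a set"
  Dom :: "'a \<Rightarrow> 'a"
  Cod :: "'a \<Rightarrow> 'a"
  Comp :: "'a \<Rightarrow> 'a \<Rightarrow> 'a"

locale category =
  fixes C :: "'a cat"
  assumes Dom_closed: "a \<in> Arr C \<Longrightarrow> Dom C a \<in> Arr C"
    and Cod_closed: "a \<in> Arr C \<Longrightarrow> Cod C a \<in> Arr C"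
    and Dom_Dom: "a \<in> Arr C \<Longrightarrow> Dom C (Dom C a) = Dom C a"
    and Cod_Dom: "a \<in> Arr C \<Longrightarrow> Cod C (Dom C a) = Dom C a"
    and Dom_Cod: "a \<in> Arr C \<Longrightarrow> Dom C (Cod C a) = Cod C a"
    and Cod_Cod: "a \<in> Arr C \<Longrightarrow> Cod C (Cod C a) = Cod C a"
    and Comp_closed: "\<lbrakk>a \<in> Arr C; b \<in> Arr C; Dom C a = Cod C b\<rbrakk> \<Longrightarrow> Comp C a b \<in> Arr C"
    and Dom_Comp: "\<lbrakk>a \<in> Arr C; b \<in> Arr C; Dom C a = Cod C b\<rbrakk> \<Longrightarrow> Dom C (Comp C a b) = Dom C b"
    and Cod_Comp: "\<lbrakk>a \<in> Arr C; b \<in> Arr C; Dom C a = Cod C b\<rbrakk> \<Longrightarrow> Cod C (Comp C a b) = Cod C a"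
    and Comp_Dom: "a \<in> Arr C \<Longrightarrow> Comp C a (Dom C a) = a"
    and Comp_Cod: "a \<in> Arr C \<Longrightarrow> Comp C (Cod C a) a = a"
    and Comp_assoc: "\<lbrakk>a \<in> Arr C; b \<in> Arr C; c \<in> Arr C; Dom C a = Cod C b; Dom C b = Cod C c\<rbrakk>
      \<Longrightarrow> Comp C (Comp C a b) c = Comp C a (Comp C b c)"

definition Obj :: "'a cat \<Rightarrow> 'a set" where
  "Obj C = {a \<in> Arr C. Dom C a = a}"

definition invertible_in :: "'a cat \<Rightarrow> 'a \<Rightarrow> bool" where
  "invertible_in C a \<longleftrightarrow> a \<in> Arr C \<and>
     (\<exists>b\<in>Arr C. Dom C b = Cod C a \<and> Cod C b = Dom C a \<and>
        Comp C b a = Dom C a \<and> Comp C a b = Cod C a)"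

text \<open>
  A functor is a function on morphisms. It is required to be \<open>undefined\<close> outside the
  source category, so that equality of functors is equality in HOL.
\<close>

definition is_functor :: "'a cat \<Rightarrow> 'b cat \<Rightarrow> ('a \<Rightarrow> 'b) \<Rightarrow> bool" where
  "is_functor C D F \<longleftrightarrow> F \<in> Arr C \<rightarrow>\<^sub>E Arr D \<and>
     (\<forall>a\<in>Arr C. F (Dom C a) = Dom D (F a)) \<and>
     (\<forall>a\<in>Arr C. F (Cod C a) = Cod D (F a)) \<and>
     (\<forall>a\<in>Arr C. \<forall>b\<in>Arr C. Dom C a = Cod C b \<longrightarrow> F (Comp C a b) = Comp D (F a) (F b))"

definition is_isomorphism :: "'a cat \<Rightarrow> 'b cat \<Rightarrow> ('a \<Rightarrow> 'b) \<Rightarrow> bool" where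
  "is_isomorphism C D F \<longleftrightarrow> is_functor C D F \<and>
     (\<exists>H. is_functor D C H \<and> (\<forall>a\<in>Arr C. H (F a) = a) \<and> (\<forall>b\<in>Arr D. F (H b) = b))"


section \<open>The fundamental groupoid\<close>

text \<open>
  HOL cannot quantify over types inside a formula, so the universal property of the category of
  fractions \<open>L[L\<^sup>-\<^sup>1]\<close> is relative to a type \<open>'x\<close> and speaks about
  all categories whose morphisms are elements of \<open>'x\<close>. Lemma
  \<open>is_fundamental_groupoid_fractions\<close> below provides, for every small category, one
  \<open>(G, i)\<close> that has the property at every type \<open>'x\<close>. Comparing two categories that
  satisfy it uses it only at the morphism types of these two categories.
\<close>

definition is_fundamental_groupoid ::
  "'x itself \<Rightarrow> 'a cat \<Rightarrow> 'g cat \<Rightarrow> ('a \<Rightarrow> 'g) \<Rightarrow> bool" where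
  "is_fundamental_groupoid _ L G i \<longleftrightarrow>
     category G \<and> is_functor L G i \<and> (\<forall>a\<in>Arr L. invertible_in G (i a)) \<and>
     (\<forall>(D :: 'x cat) F. category D \<and> is_functor L D F \<and> (\<forall>a\<in>Arr L. invertible_in D (F a)) \<longrightarrow>
        (\<exists>!F'. is_functor G D F' \<and> (\<forall>a\<in>Arr L. F' (i a) = F a)))"


section \<open>Quotient categories\<close>

inductive_set congruence_closure :: "'a cat \<Rightarrow> ('a \<times> 'a) set \<Rightarrow> ('a \<times> 'a) set"
  for C :: "'a cat" and K :: "('a \<times> 'a) set" where
  base: "(a, b) \<in> K \<Longrightarrow> (a, b) \<in> congruence_closure C K"
| refl: "a \<in> Arr C \<Longrightarrow> (a, a) \<in> congruence_closure C K"
| sym: "(a, b) \<in> congruence_closure C K \<Longrightarrow> (b, a) \<in> congruence_closure C K"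
| trans: "\<lbrakk>(a, b) \<in> congruence_closure C K; (b, c) \<in> congruence_closure C K\<rbrakk>
    \<Longrightarrow> (a, c) \<in> congruence_closure C K"
| comp: "\<lbrakk>(a, a') \<in> congruence_closure C K; (b, b') \<in> congruence_closure C K; Dom C a = Cod C b\<rbrakk>
    \<Longrightarrow> (Comp C a b, Comp C a' b') \<in> congruence_closure C K"

definition cong_class :: "'a cat \<Rightarrow> ('a \<times> 'a) set \<Rightarrow> 'a \<Rightarrow> 'a set" where
  "cong_class C K a = congruence_closure C K `` {a}"

text \<open>
  The unions below range over equal sets as soon as \<open>K\<close> consists of parallel pairs.
\<close>

definition quotient_cat :: "'a cat \<Rightarrow> ('a \<times> 'a) set \<Rightarrow> 'a set cat" where
  "quotient_cat C K = \<lparr>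
     Arr = Arr C // congruence_closure C K,
     Dom = (\<lambda>X. \<Union>a\<in>X. cong_class C K (Dom C a)),
     Cod = (\<lambda>X. \<Union>a\<in>X. cong_class C K (Cod C a)),
     Comp = (\<lambda>X Y. \<Union>a\<in>X. \<Union>b\<in>{b\<in>Y. Dom C a = Cod C b}. cong_class C K (Comp C a b)) \<rparr>"


section \<open>Graphs and path categories\<close>

record ('v, 'e) graph =
  Vert :: "'v set"
  Edge :: "'e set"
  Rng :: "'e \<Rightarrow> 'v"
  Src :: "'e \<Rightarrow> 'v"

text \<open>
  A path is a triple of its range, its list of edges in composition order, and its source; the
  empty path at \<open>v\<close> is \<open>(v, [], v)\<close>.
\<close>

type_synonym ('v, 'e) path = "'v \<times> 'e list \<times> 'v"

fun is_path :: "('v, 'e) graph \<Rightarrow> ('v, 'e) path \<Rightarrow> bool" where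
  "is_path E (v, [], w) \<longleftrightarrow> v \<in> Vert E \<and> v = w"
| "is_path E (v, e # es, w) \<longleftrightarrow> e \<in> Edge E \<and> Rng E e = v \<and> is_path E (Src E e, es, w)"

definition empty_path :: "'v \<Rightarrow> ('v, 'e) path" where
  "empty_path v = (v, [], v)"

definition path_cat :: "('v, 'e) graph \<Rightarrow> ('v, 'e) path cat" where
  "path_cat E = \<lparr>
     Arr = {p. is_path E p},
     Dom = (\<lambda>(v, es, w). empty_path w),
     Cod = (\<lambda>(v, es, w). empty_path v),
     Comp = (\<lambda>(v, es, w) (v', es', w'). (v, es @ es', w')) \<rparr>"

abbreviation path_cat_mod ::
  "('v, 'e) graph \<Rightarrow> (('v, 'e) path \<times> ('v, 'e) path) set \<Rightarrow> ('v, 'e) path set cat" where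
  "path_cat_mod E K \<equiv> quotient_cat (path_cat E) K"

text \<open>
  The vertex part and the edge part of the canonical diagram of type \<open>E\<close> in the path category
  modulo \<open>K\<close>.
\<close>

definition canonical_vert ::
  "('v, 'e) graph \<Rightarrow> (('v, 'e) path \<times> ('v, 'e) path) set \<Rightarrow> 'v \<Rightarrow> ('v, 'e) path set" where
  "canonical_vert E K v = cong_class (path_cat E) K (empty_path v)"

definition canonical_edge ::
  "('v, 'e) graph \<Rightarrow> (('v, 'e) path \<times> ('v, 'e) path) set \<Rightarrow> 'e \<Rightarrow> ('v, 'e) path set" where
  "canonical_edge E K e = cong_class (path_cat E) K (Rng E e, [e], Src E e)"

datatype 'e signed = Pos 'e | Neg 'e

fun flip :: "'e signed \<Rightarrow> 'e signed" where
  "flip (Pos e) = Neg e"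
| "flip (Neg e) = Pos e"

definition augmented :: "('v, 'e) graph \<Rightarrow> ('v, 'e signed) graph" where
  "augmented E = \<lparr>
     Vert = Vert E,
     Edge = Pos ` Edge E \<union> Neg ` Edge E,
     Rng = case_signed (Rng E) (Src E),
     Src = case_signed (Src E) (Rng E) \<rparr>"

definition cancellation_relations ::
  "('v, 'e) graph \<Rightarrow> (('v, 'e signed) path \<times> ('v, 'e signed) path) set" where
  "cancellation_relations E =
     {((Src (augmented E) x, [flip x, x], Src (augmented E) x), empty_path (Src (augmented E) x)) | x.
        x \<in> Edge (augmented E)}"


section \<open>k-graphs\<close>

text \<open>
  \<open>\<nat>\<^sup>k\<close> is the set of functions on \<open>nat\<close> that vanish at all
  indices from \<open>k\<close> on, with pointwise addition; the basis is indexed by \<open>0, \<dots>, k - 1\<close>.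
\<close>

definition Nk :: "nat \<Rightarrow> (nat \<Rightarrow> nat) set" where
  "Nk k = {n. \<forall>j\<ge>k. n j = 0}"

definition unit_deg :: "nat \<Rightarrow> nat \<Rightarrow> nat" where
  "unit_deg i = (\<lambda>j. if j = i then 1 else 0)"

locale k_graph = category L for L :: "'a cat" +
  fixes k :: nat and d :: "'a \<Rightarrow> nat \<Rightarrow> nat"
  assumes countable_Arr: "countable (Arr L)"
    and deg_Nk: "a \<in> Arr L \<Longrightarrow> d a \<in> Nk k"
    and deg_Obj: "v \<in> Obj L \<Longrightarrow> d v = 0"
    and deg_Comp: "\<lbrakk>a \<in> Arr L; b \<in> Arr L; Dom L a = Cod L b\<rbrakk> \<Longrightarrow> d (Comp L a b) = d a + d b"
    and factorization: "\<lbrakk>a \<in> Arr L; n \<in> Nk k; l \<in> Nk k; d a = n + l\<rbrakk> \<Longrightarrow>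
      \<exists>!(b, c)\<in>Arr L \<times> Arr L. d b = n \<and> d c = l \<and> Dom L b = Cod L c \<and> a = Comp L b c"

definition skeleton :: "nat \<Rightarrow> 'a cat \<Rightarrow> ('a \<Rightarrow> nat \<Rightarrow> nat) \<Rightarrow> ('a, 'a) graph" where
  "skeleton k L d = \<lparr>
     Vert = Obj L,
     Edge = (\<Union>i<k. {a \<in> Arr L. d a = unit_deg i}),
     Rng = Cod L,
     Src = Dom L \<rparr>"

definition commuting_squares ::
  "nat \<Rightarrow> 'a cat \<Rightarrow> ('a \<Rightarrow> nat \<Rightarrow> nat) \<Rightarrow> (('a, 'a signed) path \<times> ('a, 'a signed) path) set" where
  "commuting_squares k L d =
     {((Cod L e, [Pos e, Pos f], Dom L f), (Cod L g, [Pos g, Pos h], Dom L h)) | e f g h.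
        {e, f, g, h} \<subseteq> Edge (skeleton k L d) \<and> Dom L e = Cod L f \<and> d e \<noteq> d f \<and>
        Dom L g = Cod L h \<and> Comp L e f = Comp L g h \<and> d g = d f \<and> d h = d e}"


section \<open>Existence of the fundamental groupoid\<close>

locale cat_relations = category C for C :: "'a cat" +
  fixes K :: "('a \<times> 'a) set"
  assumes parallel: "(a, b) \<in> K \<Longrightarrow> a \<in> Arr C \<and> b \<in> Arr C \<and> Dom C a = Dom C b \<and> Cod C a = Cod C b"
begin

lemma cc_parallel:
  "(a, b) \<in> congruence_closure C K \<Longrightarrow>
    a \<in> Arr C \<and> b \<in> Arr C \<and> Dom C a = Dom C b \<and> Cod C a = Cod C b"
  by (induction rule: congruence_closure.induct)
    (auto dest: parallel simp: Comp_closed Dom_Comp Cod_Comp)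

lemma cc_equiv: "equiv (Arr C) (congruence_closure C K)"
  by (rule equivI)
    (auto intro!: refl_onI symI transI dest: cc_parallel intro: congruence_closure.intros)

lemma cong_class_eq_iff:
  "\<lbrakk>a \<in> Arr C; b \<in> Arr C\<rbrakk> \<Longrightarrow> cong_class C K a = cong_class C K b \<longleftrightarrow> (a, b) \<in> congruence_closure C K"
  using eq_equiv_class_iff[OF cc_equiv] by (simp add: cong_class_def)

lemma cong_class_eqI: "(a, b) \<in> congruence_closure C K \<Longrightarrow> cong_class C K a = cong_class C K b"
  using cong_class_eq_iff cc_parallel by blast

lemma mem_cong_class: "b \<in> cong_class C K a \<longleftrightarrow> (a, b) \<in> congruence_closure C K"
  by (simp add: cong_class_def)

lemma Arr_quotient: "Arr (quotient_cat C K) = cong_class C K ` Arr C"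
  by (auto simp: quotient_cat_def quotient_def cong_class_def)

lemma Dom_quotient:
  assumes "a \<in> Arr C"
  shows "Dom (quotient_cat C K) (cong_class C K a) = cong_class C K (Dom C a)"
proof -
  have "a \<in> cong_class C K a" using assms by (simp add: mem_cong_class congruence_closure.refl)
  moreover have "cong_class C K (Dom C b) = cong_class C K (Dom C a)" if "b \<in> cong_class C K a" for b
    using cc_parallel[of a b] that by (simp add: mem_cong_class)
  ultimately have "(\<Union>b\<in>cong_class C K a. cong_class C K (Dom C b)) = cong_class C K (Dom C a)"
    by (intro SUP_eq_const; blast)
  then show ?thesis by (simp add: quotient_cat_def)
qed

lemma Cod_quotient:
  assumes "a \<in> Arr C"
  shows "Cod (quotient_cat C K) (cong_class C K a) = cong_class C K (Cod C a)"
proof -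
  have "a \<in> cong_class C K a" using assms by (simp add: mem_cong_class congruence_closure.refl)
  moreover have "cong_class C K (Cod C b) = cong_class C K (Cod C a)" if "b \<in> cong_class C K a" for b
    using cc_parallel[of a b] that by (simp add: mem_cong_class)
  ultimately have "(\<Union>b\<in>cong_class C K a. cong_class C K (Cod C b)) = cong_class C K (Cod C a)"
    by (intro SUP_eq_const; blast)
  then show ?thesis by (simp add: quotient_cat_def)
qed

lemma Comp_quotient:
  assumes "a \<in> Arr C" "b \<in> Arr C" "Dom C a = Cod C b"
  shows "Comp (quotient_cat C K) (cong_class C K a) (cong_class C K b) = cong_class C K (Comp C a b)"
proof -
  have ab: "a \<in> cong_class C K a" "b \<in> cong_class C K b"
    using assms by (simp_all add: mem_cong_class congruence_closure.refl)
  have comp: "cong_class C K (Comp C a' b') = cong_class C K (Comp C a b)" "Dom C a' = Cod C b'"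
    if "a' \<in> cong_class C K a" "b' \<in> cong_class C K b" for a' b'
  proof -
    have *: "(a, a') \<in> congruence_closure C K" "(b, b') \<in> congruence_closure C K"
      using that by (simp_all add: mem_cong_class)
    show "cong_class C K (Comp C a' b') = cong_class C K (Comp C a b)"
      using cong_class_eqI[OF congruence_closure.comp[OF * assms(3)]] by simp
    show "Dom C a' = Cod C b'"
      using cc_parallel[OF *(1)] cc_parallel[OF *(2)] assms(3) by simp
  qed
  have "(\<Union>b'\<in>{b'\<in>cong_class C K b. Dom C a' = Cod C b'}. cong_class C K (Comp C a' b')) =
      cong_class C K (Comp C a b)" if "a' \<in> cong_class C K a" for a'
  proof (rule SUP_eq_const)
    show "{b' \<in> cong_class C K b. Dom C a' = Cod C b'} \<noteq> {}"
      using comp(2)[OF that ab(2)] ab(2) by blast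
  qed (use comp(1)[OF that] in simp)
  note this[simp]
  have "(\<Union>a'\<in>cong_class C K a. \<Union>b'\<in>{b'\<in>cong_class C K b. Dom C a' = Cod C b'}.
      cong_class C K (Comp C a' b')) = cong_class C K (Comp C a b)"
    by (rule SUP_eq_const) (use ab in auto)
  then show ?thesis by (simp add: quotient_cat_def)
qed

lemma cong_class_Dom_Cod:
  assumes "a \<in> Arr C" "b \<in> Arr C"
  shows "cong_class C K (Dom C a) = cong_class C K (Cod C b) \<longleftrightarrow> Dom C a = Cod C b"
  using assms cc_parallel[of "Dom C a" "Cod C b"] cong_class_eq_iff[of "Dom C a" "Cod C b"]
  by (auto simp: Dom_closed Cod_closed Dom_Dom Dom_Cod)

lemma composable_quotient_iff:
  assumes "a \<in> Arr C" "b \<in> Arr C"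
  shows "Dom (quotient_cat C K) (cong_class C K a) = Cod (quotient_cat C K) (cong_class C K b)
    \<longleftrightarrow> Dom C a = Cod C b"
  using assms by (simp add: Dom_quotient Cod_quotient cong_class_Dom_Cod)

lemma category_quotient: "category (quotient_cat C K)"
  by unfold_locales
    (auto simp: Arr_quotient cong_class_Dom_Cod Dom_quotient Cod_quotient Comp_quotient
      Dom_closed Cod_closed Dom_Dom Cod_Dom Dom_Cod Cod_Cod Comp_closed Dom_Comp Cod_Comp
      Comp_Dom Comp_Cod Comp_assoc)

end

lemma path_cat_simps:
  "Arr (path_cat E) = {p. is_path E p}"
  "Dom (path_cat E) (v, es, w) = empty_path w"
  "Cod (path_cat E) (v, es, w) = empty_path v"
  "Comp (path_cat E) (v, es, w) (v', es', w') = (v, es @ es', w')"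
  by (simp_all add: path_cat_def)

locale graph =
  fixes E :: "('v, 'e) graph"
  assumes Rng_closed: "e \<in> Edge E \<Longrightarrow> Rng E e \<in> Vert E"
    and Src_closed: "e \<in> Edge E \<Longrightarrow> Src E e \<in> Vert E"
begin

lemma is_path_ends: "is_path E (v, es, w) \<Longrightarrow> v \<in> Vert E \<and> w \<in> Vert E"
  by (induction es arbitrary: v) (auto simp: Rng_closed)

lemma is_path_append: "\<lbrakk>is_path E (v, es, w); is_path E (w, fs, u)\<rbrakk> \<Longrightarrow> is_path E (v, es @ fs, u)"
  by (induction es arbitrary: v) auto

lemma category_path_cat: "category (path_cat E)"
  by unfold_locales
    (auto simp: path_cat_simps empty_path_def is_path_append dest: is_path_ends)

lemma graph_augmented: "graph (augmented E)"
  by unfold_locales (auto simp: augmented_def Rng_closed Src_closed)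

end

lemma flip_flip: "flip (flip x) = x"
  by (cases x) auto

lemma augmented_flip:
  "x \<in> Edge (augmented E) \<Longrightarrow> flip x \<in> Edge (augmented E)"
  "Rng (augmented E) (flip x) = Src (augmented E) x"
  "Src (augmented E) (flip x) = Rng (augmented E) x"
  by (cases x; auto simp: augmented_def)+

locale path_relations = graph E for E :: "('v, 'e) graph" +
  fixes K :: "(('v, 'e) path \<times> ('v, 'e) path) set"
  assumes path_parallel: "((v, es, w), (v', es', w')) \<in> K \<Longrightarrow>
    is_path E (v, es, w) \<and> is_path E (v', es', w') \<and> v = v' \<and> w = w'"

sublocale path_relations \<subseteq> cat_relations "path_cat E" K
proof -
  interpret category "path_cat E" by (rule category_path_cat)
  show "cat_relations (path_cat E) K"
  proof
    fix a b assume *: "(a, b) \<in> K"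
    obtain v es w where a: "a = (v, es, w)" by (cases a)
    obtain v' es' w' where b: "b = (v', es', w')" by (cases b)
    show "a \<in> Arr (path_cat E) \<and> b \<in> Arr (path_cat E) \<and>
        Dom (path_cat E) a = Dom (path_cat E) b \<and> Cod (path_cat E) a = Cod (path_cat E) b"
      using path_parallel[OF *[unfolded a b]] by (auto simp: a b path_cat_simps)
  qed
qed

fun path_eval :: "'b cat \<Rightarrow> ('v \<Rightarrow> 'b) \<Rightarrow> ('e \<Rightarrow> 'b) \<Rightarrow> ('v, 'e) path \<Rightarrow> 'b" where
  "path_eval D p q (v, [], w) = p w"
| "path_eval D p q (v, e # es, w) = Comp D (q e) (path_eval D p q (v, es, w))"

context path_relations
begin

abbreviation "Q \<equiv> quotient_cat (path_cat E) K"
abbreviation "cls \<equiv> cong_class (path_cat E) K"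

lemma cls_Cons:
  assumes "is_path E (v, e # es, w)"
  shows "cls (v, e # es, w) = Comp Q (canonical_edge E K e) (cls (Src E e, es, w))"
  using assms Comp_quotient[of "(Rng E e, [e], Src E e)" "(Src E e, es, w)"]
  by (auto simp: path_cat_simps canonical_edge_def empty_path_def Src_closed)

lemma canonical_vert_in: "v \<in> Vert E \<Longrightarrow> canonical_vert E K v \<in> Arr Q"
  by (auto simp: canonical_vert_def Arr_quotient path_cat_simps empty_path_def)

lemma canonical_edge_in: "e \<in> Edge E \<Longrightarrow> canonical_edge E K e \<in> Arr Q"
  by (auto simp: canonical_edge_def Arr_quotient path_cat_simps Src_closed)

lemma Dom_canonical_edge: "e \<in> Edge E \<Longrightarrow> Dom Q (canonical_edge E K e) = canonical_vert E K (Src E e)"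
  unfolding canonical_edge_def
  by (subst Dom_quotient) (auto simp: canonical_vert_def path_cat_simps Src_closed)

lemma Cod_canonical_edge: "e \<in> Edge E \<Longrightarrow> Cod Q (canonical_edge E K e) = canonical_vert E K (Rng E e)"
  unfolding canonical_edge_def
  by (subst Cod_quotient) (auto simp: canonical_vert_def path_cat_simps Src_closed)

lemma functor_eqI:
  assumes F: "is_functor Q D F" and F': "is_functor Q D F'"
    and v: "\<And>v. v \<in> Vert E \<Longrightarrow> F (canonical_vert E K v) = F' (canonical_vert E K v)"
    and e: "\<And>e. e \<in> Edge E \<Longrightarrow> F (canonical_edge E K e) = F' (canonical_edge E K e)"
  shows "F = F'"
proof (rule PiE_ext)
  show "F \<in> Arr Q \<rightarrow>\<^sub>E Arr D" "F' \<in> Arr Q \<rightarrow>\<^sub>E Arr D"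
    using F F' by (auto simp: is_functor_def)
next
  have *: "F (cls (v, es, w)) = F' (cls (v, es, w))" if "is_path E (v, es, w)" for v es w
    using that
  proof (induction es arbitrary: v)
    case Nil
    then show ?case using v by (auto simp: canonical_vert_def empty_path_def)
  next
    case (Cons x es)
    have p: "is_path E (Src E x, es, w)" and x: "x \<in> Edge E" using Cons.prems by auto
    have m: "cls (Src E x, es, w) \<in> Arr Q" using p by (auto simp: Arr_quotient path_cat_simps)
    have "Dom Q (canonical_edge E K x) = Cod Q (cls (Src E x, es, w))"
      using p x Src_closed
      by (auto simp: canonical_edge_def composable_quotient_iff path_cat_simps)
    then show ?case
      using F F' m canonical_edge_in[OF x] e[OF x] Cons.IH[OF p]
      by (simp add: cls_Cons[OF Cons.prems] is_functor_def)
  qed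
  show "F X = F' X" if "X \<in> Arr Q" for X
    using that * by (auto simp: Arr_quotient path_cat_simps)
qed

lemma functor_exists:
  assumes "category D"
    and pv: "\<And>v. v \<in> Vert E \<Longrightarrow> p v \<in> Obj D"
    and qe: "\<And>e. e \<in> Edge E \<Longrightarrow> q e \<in> Arr D \<and> Dom D (q e) = p (Src E e) \<and> Cod D (q e) = p (Rng E e)"
    and sat: "\<And>a b. (a, b) \<in> K \<Longrightarrow> path_eval D p q a = path_eval D p q b"
  shows "\<exists>F. is_functor Q D F \<and> (\<forall>v\<in>Vert E. F (canonical_vert E K v) = p v) \<and>
    (\<forall>e\<in>Edge E. F (canonical_edge E K e) = q e)"
proof -
  interpret D: category D by fact
  let ?e = "path_eval D p q"
  have pD: "p v \<in> Arr D" "Dom D (p v) = p v" "Cod D (p v) = p v" if "v \<in> Vert E" for v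
    using pv[OF that] D.Cod_Dom[of "p v"] by (auto simp: Obj_def)
  have ev: "?e (v, es, w) \<in> Arr D \<and> Dom D (?e (v, es, w)) = p w \<and> Cod D (?e (v, es, w)) = p v"
    if "is_path E (v, es, w)" for v es w
    using that
  proof (induction es arbitrary: v)
    case Nil
    then show ?case using pD by auto
  next
    case (Cons x es)
    have "?e (v, es, w) = ?e (Src E x, es, w)" by (induction es) auto
    with Cons qe[of x] show ?case by (auto simp: D.Comp_closed D.Dom_Comp D.Cod_Comp)
  qed
  have indep: "?e (v, es, w) = ?e (v', es, w)" for v v' es w by (induction es) auto
  have app: "?e (v, es @ fs, u) = Comp D (?e (v, es, w)) (?e (w, fs, u))"
    if "is_path E (v, es, w)" "is_path E (w, fs, u)" for v es w fs u
    using that(1)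
  proof (induction es arbitrary: v)
    case Nil
    then show ?case using ev[OF that(2)] D.Comp_Cod[of "?e (w, fs, u)"] by auto
  next
    case (Cons x es)
    have path: "is_path E (Src E x, es, w)" and x: "x \<in> Edge E" using Cons.prems by auto
    show ?case
      using Cons.IH[OF path] ev[OF path] ev[OF that(2)] qe[OF x]
        indep[of v "es @ fs" u "Src E x"] indep[of v es w "Src E x"]
      by (simp add: D.Comp_assoc)
  qed
  have resp: "?e a = ?e b" if "(a, b) \<in> congruence_closure (path_cat E) K" for a b
    using that
  proof (induction rule: congruence_closure.induct)
    case (comp a a' b b')
    obtain v es w where a: "a = (v, es, w)" by (cases a)
    obtain v' es' w' where a': "a' = (v', es', w')" by (cases a')
    obtain y fs z where b: "b = (y, fs, z)" by (cases b)
    obtain y' fs' z' where b': "b' = (y', fs', z')" by (cases b')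
    have 1: "is_path E a" "is_path E a'" "w = w'" "v = v'"
      using cc_parallel[OF comp.hyps(1)] by (auto simp: a a' path_cat_simps empty_path_def)
    have 2: "is_path E b" "is_path E b'" "y = y'" "z = z'"
      using cc_parallel[OF comp.hyps(2)] by (auto simp: b b' path_cat_simps empty_path_def)
    have 3: "w = y" using comp.hyps(3) by (simp add: a b path_cat_simps empty_path_def)
    have "?e (v, es @ fs, z) = ?e (v, es' @ fs', z)"
      using 1 2 3 comp.IH by (simp add: a a' b b' app)
    then show ?case using 1 2 3 by (simp add: a a' b b' path_cat_simps)
  qed (auto simp: sat)
  define F where "F = restrict (\<lambda>X. ?e (SOME a. a \<in> X)) (Arr Q)"
  have Fcls: "F (cls a) = ?e a" if a: "is_path E a" for a
  proof -
    have aA: "a \<in> Arr (path_cat E)" using a by (simp add: path_cat_simps)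
    then have "a \<in> cls a" by (simp add: mem_cong_class congruence_closure.refl)
    then have "(SOME b. b \<in> cls a) \<in> cls a" by (rule someI)
    then have "?e (SOME b. b \<in> cls a) = ?e a" using resp by (auto simp: mem_cong_class)
    then show ?thesis using aA by (simp add: F_def Arr_quotient)
  qed
  have "is_functor Q D F"
    unfolding is_functor_def
  proof (intro conjI ballI impI)
    have "F X \<in> Arr D" if "X \<in> Arr Q" for X
      using that Fcls ev by (auto simp: Arr_quotient path_cat_simps)
    then show "F \<in> Arr Q \<rightarrow>\<^sub>E Arr D" by (auto simp: F_def)
  next
    fix X assume "X \<in> Arr Q"
    then obtain v es w where X: "X = cls (v, es, w)" "is_path E (v, es, w)"
      by (auto simp: Arr_quotient path_cat_simps)
    have A: "(v, es, w) \<in> Arr (path_cat E)" using X by (simp add: path_cat_simps)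
    have "Dom Q X = cls (w, [], w)" "Cod Q X = cls (v, [], v)"
      using Dom_quotient[OF A] Cod_quotient[OF A] X by (auto simp: path_cat_simps empty_path_def)
    then show "F (Dom Q X) = Dom D (F X)" "F (Cod Q X) = Cod D (F X)"
      using X ev[OF X(2)] is_path_ends[OF X(2)] by (auto simp: Fcls)
  next
    fix X Y assume "X \<in> Arr Q" "Y \<in> Arr Q" and c: "Dom Q X = Cod Q Y"
    then obtain v es w y fs z where X: "X = cls (v, es, w)" "is_path E (v, es, w)"
      and Y: "Y = cls (y, fs, z)" "is_path E (y, fs, z)"
      by (auto simp: Arr_quotient path_cat_simps)
    have A: "(v, es, w) \<in> Arr (path_cat E)" "(y, fs, z) \<in> Arr (path_cat E)"
      using X Y by (auto simp: path_cat_simps)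
    have c': "Dom (path_cat E) (v, es, w) = Cod (path_cat E) (y, fs, z)"
      using c composable_quotient_iff[OF A] X Y by simp
    then have wy: "w = y" by (simp add: path_cat_simps empty_path_def)
    have "Comp Q X Y = cls (v, es @ fs, z)"
      using Comp_quotient[OF A c'] X Y by (simp add: path_cat_simps)
    then show "F (Comp Q X Y) = Comp D (F X) (F Y)"
      using X Y wy by (simp add: Fcls is_path_append app)
  qed
  moreover have "F (canonical_vert E K v) = p v" if "v \<in> Vert E" for v
    using that by (simp add: canonical_vert_def empty_path_def Fcls)
  moreover have "F (canonical_edge E K e) = q e" if "e \<in> Edge E" for e
    using that qe[OF that] D.Comp_Dom[of "q e"]
    by (simp add: canonical_edge_def Fcls Src_closed)
  ultimately show ?thesis by blast
qed

end

text \<open>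
  The Gabriel-Zisman construction: paths in the morphisms of \<open>L\<close> and their formal inverses, modulo
  cancellation and the composition of \<open>L\<close>.
\<close>

definition arrow_graph :: "'a cat \<Rightarrow> ('a, 'a) graph" where
  "arrow_graph L = \<lparr>Vert = Obj L, Edge = Arr L, Rng = Cod L, Src = Dom L\<rparr>"

definition composition_relations :: "'a cat \<Rightarrow> (('a, 'a signed) path \<times> ('a, 'a signed) path) set" where
  "composition_relations L =
     {((Cod L a, [Pos a, Pos b], Dom L b), (Cod L a, [Pos (Comp L a b)], Dom L b)) | a b.
        a \<in> Arr L \<and> b \<in> Arr L \<and> Dom L a = Cod L b} \<union>
     {((v, [Pos v], v), empty_path v) | v. v \<in> Obj L}"

definition fraction_relations :: "'a cat \<Rightarrow> (('a, 'a signed) path \<times> ('a, 'a signed) path) set" where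
  "fraction_relations L = cancellation_relations (arrow_graph L) \<union> composition_relations L"

definition fractions :: "'a cat \<Rightarrow> ('a, 'a signed) path set cat" where
  "fractions L = path_cat_mod (augmented (arrow_graph L)) (fraction_relations L)"

definition fractions_incl :: "'a cat \<Rightarrow> 'a \<Rightarrow> ('a, 'a signed) path set" where
  "fractions_incl L =
     restrict (\<lambda>a. canonical_edge (augmented (arrow_graph L)) (fraction_relations L) (Pos a)) (Arr L)"

lemma (in category) inverse_unique:
  assumes "a \<in> Arr C" "b \<in> Arr C" "c \<in> Arr C"
    "Dom C b = Cod C a" "Cod C b = Dom C a" "Dom C c = Cod C a" "Cod C c = Dom C a"
    "Comp C b a = Dom C a" "Comp C a c = Cod C a"
  shows "b = c"
proof -
  have "b = Comp C b (Comp C a c)" using assms Comp_Dom[of b] by simp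
  also have "\<dots> = Comp C (Comp C b a) c" using Comp_assoc[of b a c] assms by simp
  also have "\<dots> = c" using assms Comp_Cod[of c] by simp
  finally show ?thesis .
qed

lemma (in category) is_fundamental_groupoid_fractions:
  "is_fundamental_groupoid TYPE('x) C (fractions C) (fractions_incl C)"
proof -
  let ?E = "augmented (arrow_graph C)" and ?K = "fraction_relations C"
  interpret A: graph "arrow_graph C"
    by unfold_locales (auto simp: arrow_graph_def Obj_def Dom_closed Cod_closed Dom_Dom Dom_Cod)
  interpret E: graph ?E by (rule A.graph_augmented)
  have cod_obj: "Cod C v = v" if "v \<in> Obj C" for v
    using that Cod_Dom[of v] by (auto simp: Obj_def)
  have ObjA: "Dom C a \<in> Obj C" "Cod C a \<in> Obj C" if "a \<in> Arr C" for a
    using that by (auto simp: Obj_def Dom_closed Cod_closed Dom_Dom Dom_Cod)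
  note C_closed = Dom_closed Cod_closed Comp_closed and C_Comp = Dom_Comp Cod_Comp
  interpret path_relations ?E ?K
  proof
    fix v es w v' es' w' assume *: "((v, es, w), (v', es', w')) \<in> ?K"
    show "is_path ?E (v, es, w) \<and> is_path ?E (v', es', w') \<and> v = v' \<and> w = w'"
    proof (cases "((v, es, w), (v', es', w')) \<in> cancellation_relations (arrow_graph C)")
      case True
      then show ?thesis
        by (auto simp: cancellation_relations_def empty_path_def augmented_flip
            intro: E.Src_closed)
    next
      case False
      then have "((v, es, w), (v', es', w')) \<in> composition_relations C"
        using * by (simp add: fraction_relations_def)
      then show ?thesis
        by (auto simp: composition_relations_def empty_path_def augmented_def arrow_graph_def
            Comp_closed Dom_Comp Cod_Comp ObjA cod_obj, auto simp: Obj_def)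
    qed
  qed
  have Q: "fractions C = Q" by (simp add: fractions_def)
  have catQ: "category Q" by (rule category_quotient)
  let ?v = "canonical_vert ?E ?K" and ?e = "canonical_edge ?E ?K"
  have E_simps: "Vert ?E = Obj C" "Edge ?E = Pos ` Arr C \<union> Neg ` Arr C"
    "Rng ?E (Pos a) = Cod C a" "Src ?E (Pos a) = Dom C a"
    "Rng ?E (Neg a) = Dom C a" "Src ?E (Neg a) = Cod C a" for a
    by (auto simp: augmented_def arrow_graph_def)
  have comp2: "Comp Q (?e x) (?e y) = cls (Rng ?E x, [x, y], Src ?E y)"
    if "x \<in> Edge ?E" "y \<in> Edge ?E" "Src ?E x = Rng ?E y" for x y
    using that E.Src_closed cls_Cons[of "Rng ?E x" x "[y]" "Src ?E y"]
    by (simp add: canonical_edge_def)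
  have cancel: "Comp Q (?e (flip x)) (?e x) = ?v (Src ?E x)" if "x \<in> Edge ?E" for x
  proof -
    have "((Src ?E x, [flip x, x], Src ?E x), empty_path (Src ?E x)) \<in> ?K"
      using that by (auto simp: fraction_relations_def cancellation_relations_def)
    then have "cls (Src ?E x, [flip x, x], Src ?E x) = cls (empty_path (Src ?E x))"
      by (intro cong_class_eqI congruence_closure.base)
    then show ?thesis
      using comp2[of "flip x" x] that by (simp add: augmented_flip canonical_vert_def)
  qed
  have comp: "?e (Pos (Comp C a b)) = Comp Q (?e (Pos a)) (?e (Pos b))"
    if "a \<in> Arr C" "b \<in> Arr C" "Dom C a = Cod C b" for a b
  proof -
    have "((Cod C a, [Pos a, Pos b], Dom C b), (Cod C a, [Pos (Comp C a b)], Dom C b)) \<in> ?K"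
      using that by (auto simp: fraction_relations_def composition_relations_def)
    then have "cls (Cod C a, [Pos a, Pos b], Dom C b) = cls (Cod C a, [Pos (Comp C a b)], Dom C b)"
      by (intro cong_class_eqI congruence_closure.base)
    then show ?thesis using that comp2[of "Pos a" "Pos b"]
      by (simp add: E_simps canonical_edge_def C_Comp)
  qed
  have ident: "?e (Pos v) = ?v v" if "v \<in> Obj C" for v
  proof -
    have "((v, [Pos v], v), empty_path v) \<in> ?K"
      using that by (auto simp: fraction_relations_def composition_relations_def)
    then have "cls (v, [Pos v], v) = cls (empty_path v)"
      by (intro cong_class_eqI congruence_closure.base)
    then show ?thesis using that cod_obj[OF that]
      by (simp add: canonical_edge_def canonical_vert_def E_simps Obj_def)
  qed
  have i: "fractions_incl C a = ?e (Pos a)" if "a \<in> Arr C" for a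
    using that by (simp add: fractions_incl_def)
  have fun_i: "is_functor C Q (fractions_incl C)"
    unfolding is_functor_def
  proof (intro conjI ballI impI)
    show "fractions_incl C \<in> Arr C \<rightarrow>\<^sub>E Arr Q"
      by (auto simp: fractions_incl_def E_simps intro!: canonical_edge_in)
  qed (auto simp: i C_closed C_Comp comp ident ObjA Dom_canonical_edge
        Cod_canonical_edge E_simps)
  have inv_i: "invertible_in Q (?e (Pos a))" if "a \<in> Arr C" for a
    unfolding invertible_in_def
    using that cancel[of "Pos a"] cancel[of "Neg a"]
    by (auto simp: E_simps Dom_canonical_edge Cod_canonical_edge
        intro!: canonical_edge_in bexI[of _ "?e (Neg a)"])
  have univ: "\<exists>!F'. is_functor Q D F' \<and> (\<forall>a\<in>Arr C. F' (fractions_incl C a) = F a)"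
    if D: "category D" and F: "is_functor C D F" and inv: "\<forall>a\<in>Arr C. invertible_in D (F a)"
    for D :: "'x cat" and F
  proof (rule ex_ex1I)
    interpret D: category D by (rule D)
    have "\<forall>a\<in>Arr C. \<exists>b. b \<in> Arr D \<and> Dom D b = Cod D (F a) \<and> Cod D b = Dom D (F a) \<and>
        Comp D b (F a) = Dom D (F a) \<and> Comp D (F a) b = Cod D (F a)"
      using inv by (auto simp: invertible_in_def)
    then obtain J where J: "\<forall>a\<in>Arr C. J a \<in> Arr D \<and> Dom D (J a) = Cod D (F a) \<and>
        Cod D (J a) = Dom D (F a) \<and> Comp D (J a) (F a) = Dom D (F a) \<and> Comp D (F a) (J a) = Cod D (F a)"
      by metis
    have FA: "F a \<in> Arr D" "Dom D (F a) = F (Dom C a)" "Cod D (F a) = F (Cod C a)" if "a \<in> Arr C" for a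
      using F that by (auto simp: is_functor_def)
    have F_obj: "F v \<in> Obj D" if "v \<in> Obj C" for v
      using that FA[of v] by (auto simp: Obj_def)
    have F_comp: "F (Comp C a b) = Comp D (F a) (F b)"
      if "a \<in> Arr C" "b \<in> Arr C" "Dom C a = Cod C b" for a b
      using F that by (auto simp: is_functor_def)
    let ?q = "case_signed F J"
    have sat: "path_eval D F ?q a = path_eval D F ?q b" if "(a, b) \<in> ?K" for a b
    proof -
      have DF: "Comp D (F a) (F (Dom C a)) = F a" "Comp D (J a) (F (Cod C a)) = J a"
        if "a \<in> Arr C" for a
        using that D.Comp_Dom[of "F a"] D.Comp_Dom[of "J a"] FA[OF that] J by auto
      have "Comp D (F v) (F v) = F v" if "v \<in> Arr C" "Dom C v = v" for v
        using DF(1)[OF that(1)] that(2) by simp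
      then show ?thesis
        using that J FA DF F_comp DF[OF C_closed(3)] C_Comp
        unfolding fraction_relations_def cancellation_relations_def composition_relations_def
        by (auto simp: E_simps empty_path_def Obj_def)
    qed
    have "\<exists>F'. is_functor Q D F' \<and> (\<forall>v\<in>Vert ?E. F' (?v v) = F v) \<and> (\<forall>e\<in>Edge ?E. F' (?e e) = ?q e)"
      by (rule functor_exists[OF D _ _ sat]) (use J FA F_obj in \<open>auto simp: E_simps\<close>)
    then show "\<exists>F'. is_functor Q D F' \<and> (\<forall>a\<in>Arr C. F' (fractions_incl C a) = F a)"
      by (auto simp: i E_simps)
  next
    interpret D: category D by (rule D)
    fix F1 F2
    assume 1: "is_functor Q D F1 \<and> (\<forall>a\<in>Arr C. F1 (fractions_incl C a) = F a)"
      and 2: "is_functor Q D F2 \<and> (\<forall>a\<in>Arr C. F2 (fractions_incl C a) = F a)"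
    have pos: "F1 (?e (Pos a)) = F a" "F2 (?e (Pos a)) = F a" if "a \<in> Arr C" for a
      using 1 2 that i by auto
    have vert: "F1 (?v v) = F v" "F2 (?v v) = F v" if "v \<in> Obj C" for v
      using pos[of v] that ident[OF that] by (auto simp: Obj_def)
    have neg: "H (?e (Neg a)) \<in> Arr D \<and> Dom D (H (?e (Neg a))) = F (Cod C a) \<and>
        Cod D (H (?e (Neg a))) = F (Dom C a) \<and>
        Comp D (H (?e (Neg a))) (F a) = F (Dom C a) \<and> Comp D (F a) (H (?e (Neg a))) = F (Cod C a)"
      if a: "a \<in> Arr C" and H: "is_functor Q D H" "\<And>a. a \<in> Arr C \<Longrightarrow> H (?e (Pos a)) = F a" for a H
    proof -
      have Hv: "H (?v v) = F v" if "v \<in> Obj C" for v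
        using H(2)[of v] that ident[OF that] by (auto simp: Obj_def)
      have m: "?e (Neg a) \<in> Arr Q" "?e (Pos a) \<in> Arr Q"
        using a by (auto simp: E_simps intro!: canonical_edge_in)
      have dn: "Dom Q (?e (Neg a)) = ?v (Cod C a)" "Cod Q (?e (Neg a)) = ?v (Dom C a)"
        "Dom Q (?e (Pos a)) = ?v (Dom C a)" "Cod Q (?e (Pos a)) = ?v (Cod C a)"
        using a by (auto simp: E_simps Dom_canonical_edge Cod_canonical_edge)
      have c: "Comp Q (?e (Neg a)) (?e (Pos a)) = ?v (Dom C a)"
        "Comp Q (?e (Pos a)) (?e (Neg a)) = ?v (Cod C a)"
        using a cancel[of "Pos a"] cancel[of "Neg a"] by (auto simp: E_simps)
      have Hd: "\<And>X. X \<in> Arr Q \<Longrightarrow> H (Dom Q X) = Dom D (H X) \<and> H (Cod Q X) = Cod D (H X) \<and> H X \<in> Arr D"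
        and Hc: "\<And>X Y. \<lbrakk>X \<in> Arr Q; Y \<in> Arr Q; Dom Q X = Cod Q Y\<rbrakk> \<Longrightarrow> H (Comp Q X Y) = Comp D (H X) (H Y)"
        using H(1) by (auto simp: is_functor_def)
      show ?thesis
        using Hd[OF m(1)] Hc[OF m] Hc[OF m(2) m(1)] H(2)[OF a] Hv ObjA[OF a] by (simp add: dn c)
    qed
    have "F1 (?e (Neg a)) = F2 (?e (Neg a))" if a: "a \<in> Arr C" for a
      by (rule D.inverse_unique[of "F a"])
        (use neg[OF a, of F1] neg[OF a, of F2] 1 2 pos F a in \<open>auto simp: is_functor_def\<close>)
    then show "F1 = F2"
      using 1 2 pos vert by (intro functor_eqI[of D]) (auto simp: E_simps)
  qed
  show ?thesis
    unfolding is_fundamental_groupoid_def Q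
    using catQ fun_i inv_i univ by (auto simp: i)
qed

end

theory Submission
  imports Defs
begin

text \<open>
  A \<open>k\<close>-graph \<open>\<Lambda>\<close> is isomorphic to \<open>\<P>(E)/S\<close>: every morphism is a composite of edges, and two
  edge paths with the same composite are congruent because the factorization property allows any
  edge to be moved to the front by commuting squares. For an arbitrary graph \<open>E\<close> and set \<open>K\<close> of
  relations, a functor on \<open>\<P>(E)/K\<close> that inverts the edges extends uniquely to
  \<open>\<P>(E\<^sup>+)/(C \<union> K)\<close>, which is therefore the category of fractions of \<open>\<P>(E)/K\<close>. It remains to use
  that the category of fractions is unique up to a unique isomorphism.
\<close>

section \<open>Functors and invertible morphisms\<close>

lemma is_functorD:
  assumes "is_functor C D F"
  shows "a \<in> Arr C \<Longrightarrow> F a \<in> Arr D"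
    and "a \<in> Arr C \<Longrightarrow> F (Dom C a) = Dom D (F a)"
    and "a \<in> Arr C \<Longrightarrow> F (Cod C a) = Cod D (F a)"
    and "\<lbrakk>a \<in> Arr C; b \<in> Arr C; Dom C a = Cod C b\<rbrakk> \<Longrightarrow> F (Comp C a b) = Comp D (F a) (F b)"
  using assms by (auto simp: is_functor_def)

lemma is_functor_Obj: "\<lbrakk>is_functor C D F; v \<in> Obj C\<rbrakk> \<Longrightarrow> F v \<in> Obj D"
  by (auto simp: Obj_def is_functorD(1) simp flip: is_functorD(2))

lemma ex_inverse_isomorphism:
  assumes "is_isomorphism C D F"
  shows "\<exists>H. is_isomorphism D C H \<and> (\<forall>a\<in>Arr C. H (F a) = a) \<and> (\<forall>b\<in>Arr D. F (H b) = b)"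
  using assms unfolding is_isomorphism_def by blast

context category
begin

lemma Obj_simps:
  assumes "v \<in> Obj C"
  shows "v \<in> Arr C" "Dom C v = v" "Cod C v = v"
  using assms Cod_Dom[of v] by (auto simp: Obj_def)

lemma Dom_Cod_in_Obj:
  assumes "a \<in> Arr C"
  shows "Dom C a \<in> Obj C" "Cod C a \<in> Obj C"
  using assms by (auto simp: Obj_def Dom_closed Cod_closed Dom_Dom Dom_Cod)

lemma is_functor_restrict:
  assumes "\<And>a. a \<in> Arr C \<Longrightarrow> F a \<in> Arr D"
    and "\<And>a. a \<in> Arr C \<Longrightarrow> F (Dom C a) = Dom D (F a)"
    and "\<And>a. a \<in> Arr C \<Longrightarrow> F (Cod C a) = Cod D (F a)"
    and "\<And>a b. \<lbrakk>a \<in> Arr C; b \<in> Arr C; Dom C a = Cod C b\<rbrakk> \<Longrightarrow> F (Comp C a b) = Comp D (F a) (F b)"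
  shows "is_functor C D (restrict F (Arr C))"
  using assms by (auto simp: is_functor_def Dom_closed Cod_closed Comp_closed)

lemma is_functor_compose:
  assumes F: "is_functor C D F" and H: "is_functor D B H"
  shows "is_functor C B (compose (Arr C) H F)"
  unfolding compose_def
proof (rule is_functor_restrict)
  fix a b assume "a \<in> Arr C" "b \<in> Arr C" "Dom C a = Cod C b"
  then show "H (F (Comp C a b)) = Comp B (H (F a)) (H (F b))"
    using is_functorD(2)[OF F, of a] is_functorD(3)[OF F, of b]
    by (simp add: is_functorD(1,4)[OF F] is_functorD(4)[OF H])
qed (simp_all add: is_functorD[OF F] is_functorD[OF H])

lemma is_functor_id: "is_functor C C (restrict id (Arr C))"
  by (rule is_functor_restrict) auto

lemma is_isomorphism_if_bij_betw:
  assumes D: "category D" and F: "is_functor C D F" and bij: "bij_betw F (Arr C) (Arr D)"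
  shows "is_isomorphism C D F"
proof -
  let ?H = "inv_into (Arr C) F"
  have HF: "?H (F a) = a" if "a \<in> Arr C" for a
    by (rule bij_betw_inv_into_left[OF bij that])
  have surj: "\<exists>a\<in>Arr C. b = F a" if "b \<in> Arr D" for b
    using bij that by (auto simp: bij_betw_def)
  have "is_functor D C (restrict ?H (Arr D))"
  proof (rule category.is_functor_restrict[OF D])
    fix b assume "b \<in> Arr D"
    then obtain a where "a \<in> Arr C" "b = F a" using surj by blast
    then show "?H b \<in> Arr C" "?H (Dom D b) = Dom C (?H b)" "?H (Cod D b) = Cod C (?H b)"
      by (simp_all add: HF Dom_closed Cod_closed flip: is_functorD(2,3)[OF F])
  next
    fix b b' assume "b \<in> Arr D" "b' \<in> Arr D" and D_comp: "Dom D b = Cod D b'"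
    then obtain a a' where a: "a \<in> Arr C" "b = F a" "a' \<in> Arr C" "b' = F a'" using surj by meson
    have "F (Dom C a) = F (Cod C a')" using D_comp a by (simp add: is_functorD(2,3)[OF F])
    then have "Dom C a = Cod C a'" using HF a by (metis Dom_closed Cod_closed)
    then show "?H (Comp D b b') = Comp C (?H b) (?H b')"
      using a by (simp add: HF Comp_closed flip: is_functorD(4)[OF F])
  qed
  moreover have "F (?H b) = b" if "b \<in> Arr D" for b
    by (rule bij_betw_inv_into_right[OF bij that])
  ultimately show ?thesis
    using F HF unfolding is_isomorphism_def
    by (intro conjI exI[of _ "restrict ?H (Arr D)"]) (auto simp: is_functorD(1))
qed

end

definition inverse_in :: "'a cat \<Rightarrow> 'a \<Rightarrow> 'a \<Rightarrow> bool" where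
  "inverse_in C a b \<longleftrightarrow> a \<in> Arr C \<and> b \<in> Arr C \<and> Dom C b = Cod C a \<and> Cod C b = Dom C a \<and>
     Comp C b a = Dom C a \<and> Comp C a b = Cod C a"

lemma invertible_in_iff: "invertible_in C a \<longleftrightarrow> (\<exists>b. inverse_in C a b)"
  by (auto simp: invertible_in_def inverse_in_def)

lemma inverse_in_sym: "inverse_in C a b \<Longrightarrow> inverse_in C b a"
  by (simp add: inverse_in_def)

lemma inverse_in_functor:
  assumes F: "is_functor C D F" and "inverse_in C a b"
  shows "inverse_in D (F a) (F b)"
  using assms(2) is_functorD[OF F, of a] is_functorD[OF F, of b] unfolding inverse_in_def by metis

context category
begin

lemma inverse_in_unique: "\<lbrakk>inverse_in C a b; inverse_in C a c\<rbrakk> \<Longrightarrow> b = c"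
  by (rule inverse_unique[of a]) (auto simp: inverse_in_def)

lemma invertible_Obj: "v \<in> Obj C \<Longrightarrow> invertible_in C v"
  using Obj_simps[of v] Comp_Dom[of v] by (auto simp: invertible_in_def)

lemma Comp_inverses_cancel:
  assumes "inverse_in C a a'" "inverse_in C b b'" "Dom C a = Cod C b"
  shows "Comp C (Comp C b' a') (Comp C a b) = Dom C b"
proof -
  have "Comp C (Comp C b' a') (Comp C a b) = Comp C b' (Comp C (Comp C a' a) b)"
    using assms Comp_assoc[of a' a b] by (simp add: inverse_in_def Comp_assoc Comp_closed Cod_Comp)
  also have "\<dots> = Dom C b"
    using assms by (simp add: inverse_in_def Comp_Cod)
  finally show ?thesis .
qed

lemma inverse_in_Comp:
  assumes "inverse_in C a a'" "inverse_in C b b'" "Dom C a = Cod C b"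
  shows "inverse_in C (Comp C a b) (Comp C b' a')"
  using assms Comp_inverses_cancel[OF assms]
    Comp_inverses_cancel[OF assms(2,1)[THEN inverse_in_sym]]
  by (simp add: inverse_in_def Comp_closed Dom_Comp Cod_Comp)

lemma invertible_Comp:
  assumes "invertible_in C a" "invertible_in C b" "Dom C a = Cod C b"
  shows "invertible_in C (Comp C a b)"
  using assms inverse_in_Comp by (meson invertible_in_iff)

end

section \<open>Uniqueness of the fundamental groupoid\<close>

lemma is_fundamental_groupoidD:
  assumes "is_fundamental_groupoid TYPE('x) L G i"
  shows "category G" "is_functor L G i" "\<And>a. a \<in> Arr L \<Longrightarrow> invertible_in G (i a)"
    and "\<And>(D :: 'x cat) F. \<lbrakk>category D; is_functor L D F; \<And>a. a \<in> Arr L \<Longrightarrow> invertible_in D (F a)\<rbrakk>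
      \<Longrightarrow> \<exists>!F'. is_functor G D F' \<and> (\<forall>a\<in>Arr L. F' (i a) = F a)"
  using assms unfolding is_fundamental_groupoid_def by blast+

lemma fundamental_groupoid_endo_id:
  fixes G :: "'g cat"
  assumes G: "is_fundamental_groupoid TYPE('g) L G i"
    and F: "is_functor G G F" "\<And>a. a \<in> Arr L \<Longrightarrow> F (i a) = i a" and b: "b \<in> Arr G"
  shows "F b = b"
proof -
  note univ = is_fundamental_groupoidD[OF G]
  interpret category G by (rule univ(1))
  have "\<forall>a\<in>Arr L. restrict id (Arr G) (i a) = i a"
    using is_functorD(1)[OF univ(2)] by simp
  then have "F = restrict id (Arr G)"
    using univ(4)[OF univ(1-3)] F is_functor_id by blast
  then show ?thesis using b by simp
qed

theorem fundamental_groupoid_unique: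
  fixes G :: "'g cat" and G' :: "'h cat"
  assumes G: "is_fundamental_groupoid TYPE('g) L G i" "is_fundamental_groupoid TYPE('h) L G i"
    and G': "is_fundamental_groupoid TYPE('g) L G' i'" "is_fundamental_groupoid TYPE('h) L G' i'"
  shows "\<exists>!T. is_isomorphism G G' T \<and> (\<forall>a\<in>Arr L. T (i a) = i' a)"
proof -
  note univ = is_fundamental_groupoidD[OF G(2)] and univ' = is_fundamental_groupoidD[OF G'(1)]
  interpret G: category G by (rule univ)
  interpret G': category G' by (rule univ')
  have mem: "i a \<in> Arr G" "i' a \<in> Arr G'" if "a \<in> Arr L" for a
    using that is_functorD(1)[OF univ(2)] is_functorD(1)[OF univ'(2)] by auto
  have ex1: "\<exists>!T. is_functor G G' T \<and> (\<forall>a\<in>Arr L. T (i a) = i' a)"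
    by (rule univ(4)[OF univ'(1-3)])
  then obtain T where T: "is_functor G G' T" "\<And>a. a \<in> Arr L \<Longrightarrow> T (i a) = i' a" by blast
  obtain H where H: "is_functor G' G H" "\<And>a. a \<in> Arr L \<Longrightarrow> H (i' a) = i a"
    using univ'(4)[OF univ(1-3)] by blast
  have "H (T b) = b" if "b \<in> Arr G" for b
    using fundamental_groupoid_endo_id[OF G(1) G.is_functor_compose[OF T(1) H(1)] _ that]
    by (simp add: compose_def T H mem that)
  moreover have "T (H b) = b" if "b \<in> Arr G'" for b
    using fundamental_groupoid_endo_id[OF G'(2) G'.is_functor_compose[OF H(1) T(1)] _ that]
    by (simp add: compose_def T H mem that)
  ultimately have "is_isomorphism G G' T" using T(1) H(1) by (auto simp: is_isomorphism_def)
  then show ?thesis using T(2) ex1 unfolding is_isomorphism_def by blast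
qed

lemma (in category) is_fundamental_groupoid_compose_isomorphism:
  assumes D: "is_fundamental_groupoid TYPE('x) D G j" "category D" and iso: "is_isomorphism C D \<Phi>"
  shows "is_fundamental_groupoid TYPE('x) C G (compose (Arr C) j \<Phi>)"
proof -
  interpret D: category D by fact
  note univ = is_fundamental_groupoidD[OF D(1)]
  have \<Phi>: "is_functor C D \<Phi>" using iso by (simp add: is_isomorphism_def)
  obtain \<Psi> where \<Psi>_iso: "is_isomorphism D C \<Psi>" and \<Psi>\<Phi>: "\<And>a. a \<in> Arr C \<Longrightarrow> \<Psi> (\<Phi> a) = a"
    and \<Phi>\<Psi>: "\<And>b. b \<in> Arr D \<Longrightarrow> \<Phi> (\<Psi> b) = b"
    using ex_inverse_isomorphism[OF iso] by blast
  have \<Psi>: "is_functor D C \<Psi>" using \<Psi>_iso by (simp add: is_isomorphism_def)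
  have "\<exists>!F'. is_functor G B F' \<and> (\<forall>a\<in>Arr C. F' (compose (Arr C) j \<Phi> a) = F a)"
    if B: "category B" and F: "is_functor C B F" and inv: "\<And>a. a \<in> Arr C \<Longrightarrow> invertible_in B (F a)"
    for B :: "'x cat" and F
  proof -
    have "(\<forall>b\<in>Arr D. F' (j b) = compose (Arr D) F \<Psi> b) \<longleftrightarrow>
        (\<forall>a\<in>Arr C. F' (compose (Arr C) j \<Phi> a) = F a)" for F'
      using is_functorD(1)[OF \<Phi>] is_functorD(1)[OF \<Psi>] \<Psi>\<Phi> \<Phi>\<Psi> by (metis compose_eq)
    moreover have "\<exists>!F'. is_functor G B F' \<and> (\<forall>b\<in>Arr D. F' (j b) = compose (Arr D) F \<Psi> b)"
      using univ(4)[OF B D.is_functor_compose[OF \<Psi> F]] inv is_functorD(1)[OF \<Psi>]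
      by (simp add: compose_eq)
    ultimately show ?thesis by simp
  qed
  then show ?thesis
    using univ(1-3) is_functor_compose[OF \<Phi>] is_functorD(1)[OF \<Phi>]
    by (simp add: is_fundamental_groupoid_def compose_eq)
qed

section \<open>Diagrams\<close>

definition is_diagram ::
  "('v, 'e) graph \<Rightarrow> 'b cat \<Rightarrow> ('v \<Rightarrow> 'b) \<Rightarrow> ('e \<Rightarrow> 'b) \<Rightarrow> bool" where
  "is_diagram E D p q \<longleftrightarrow> (\<forall>v\<in>Vert E. p v \<in> Obj D) \<and>
     (\<forall>e\<in>Edge E. q e \<in> Arr D \<and> Dom D (q e) = p (Src E e) \<and> Cod D (q e) = p (Rng E e))"

definition satisfies ::
  "'b cat \<Rightarrow> ('v \<Rightarrow> 'b) \<Rightarrow> ('e \<Rightarrow> 'b) \<Rightarrow> (('v, 'e) path \<times> ('v, 'e) path) set \<Rightarrow> bool" where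
  "satisfies D p q K \<longleftrightarrow> (\<forall>(a, b)\<in>K. path_eval D p q a = path_eval D p q b)"

lemma is_diagramD:
  assumes "is_diagram E D p q"
  shows "v \<in> Vert E \<Longrightarrow> p v \<in> Obj D"
    and "e \<in> Edge E \<Longrightarrow> q e \<in> Arr D"
    and "e \<in> Edge E \<Longrightarrow> Dom D (q e) = p (Src E e)"
    and "e \<in> Edge E \<Longrightarrow> Cod D (q e) = p (Rng E e)"
  using assms by (auto simp: is_diagram_def)

lemma satisfiesI:
  "(\<And>a b. (a, b) \<in> K \<Longrightarrow> path_eval D p q a = path_eval D p q b) \<Longrightarrow> satisfies D p q K"
  by (auto simp: satisfies_def)

lemma satisfiesD: "\<lbrakk>satisfies D p q K; (a, b) \<in> K\<rbrakk> \<Longrightarrow> path_eval D p q a = path_eval D p q b"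
  by (auto simp: satisfies_def)

lemma satisfies_Un: "satisfies D p q (K \<union> K') \<longleftrightarrow> satisfies D p q K \<and> satisfies D p q K'"
  by (auto simp: satisfies_def)

lemma is_diagram_functor:
  assumes "is_functor C D F" "is_diagram E C p q"
  shows "is_diagram E D (\<lambda>v. F (p v)) (\<lambda>e. F (q e))"
  using assms is_functor_Obj[OF assms(1)]
  by (auto simp: is_diagram_def is_functorD(1) simp flip: is_functorD(2,3))

lemma path_induct [consumes 1, case_names empty Cons]:
  assumes "is_path E a"
    and "\<And>v. v \<in> Vert E \<Longrightarrow> P (v, [], v)"
    and "\<And>e es w. \<lbrakk>e \<in> Edge E; is_path E (Src E e, es, w); P (Src E e, es, w)\<rbrakk>
      \<Longrightarrow> P (Rng E e, e # es, w)"
  shows "P a"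
proof -
  have "P (v, es, w)" if "is_path E (v, es, w)" for v es w
    using that by (induction es arbitrary: v) (use assms(2,3) in auto)
  then show ?thesis using assms(1) by (cases a) blast
qed

lemma path_eval_eq_foldr: "path_eval D p q (v, es, w) = foldr (\<lambda>e. Comp D (q e)) es (p w)"
  by (induction es) auto

lemma path_eval_cong:
  assumes "is_path E a" "\<And>v. v \<in> Vert E \<Longrightarrow> p v = p' v" "\<And>e. e \<in> Edge E \<Longrightarrow> q e = q' e"
  shows "path_eval D p q a = path_eval D p' q' a"
  using assms(1)
proof (induction rule: path_induct)
  case (Cons e es w)
  then show ?case using assms(3) by (simp add: path_eval_eq_foldr)
qed (use assms(2) in simp)

context category
begin

lemma path_eval_closed:
  assumes diagram: "is_diagram E C p q" and path: "is_path E (v, es, w)"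
  shows "path_eval C p q (v, es, w) \<in> Arr C"
    and "Dom C (path_eval C p q (v, es, w)) = p w"
    and "Cod C (path_eval C p q (v, es, w)) = p v"
proof -
  let ?ev = "path_eval C p q"
  have "?ev (v, es, w) \<in> Arr C \<and> Dom C (?ev (v, es, w)) = p w \<and> Cod C (?ev (v, es, w)) = p v"
    using path
  proof (induction "(v, es, w)" arbitrary: v es w rule: path_induct)
    case (empty v)
    then show ?case using is_diagramD(1)[OF diagram] by (simp add: Obj_simps)
  next
    case (Cons e es w)
    then show ?case
      using is_diagramD[OF diagram]
      by (simp add: path_eval_eq_foldr Comp_closed Dom_Comp Cod_Comp)
  qed
  then show "?ev (v, es, w) \<in> Arr C" "Dom C (?ev (v, es, w)) = p w" "Cod C (?ev (v, es, w)) = p v"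
    by simp_all
qed

lemma functor_path_eval:
  assumes diagram: "is_diagram E C p q" and F: "is_functor C D F" and path: "is_path E a"
  shows "F (path_eval C p q a) = path_eval D (\<lambda>v. F (p v)) (\<lambda>e. F (q e)) a"
  using path
proof (induction rule: path_induct)
  case (Cons e es w)
  then show ?case
    using is_diagramD[OF diagram] path_eval_closed[OF diagram Cons.hyps(2)]
    by (simp add: path_eval_eq_foldr is_functorD(4)[OF F])
qed simp

lemma invertible_path_eval:
  assumes diagram: "is_diagram E C p q" and inv: "\<And>e. e \<in> Edge E \<Longrightarrow> invertible_in C (q e)"
    and path: "is_path E a"
  shows "invertible_in C (path_eval C p q a)"
  using path
proof (induction rule: path_induct)
  case (empty v)
  then show ?case using is_diagramD(1)[OF diagram] by (simp add: invertible_Obj)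
next
  case (Cons e es w)
  then show ?case
    using inv is_diagramD(3)[OF diagram] path_eval_closed(3)[OF diagram Cons.hyps(2)]
    by (simp add: path_eval_eq_foldr invertible_Comp)
qed

end

context path_relations
begin

abbreviation cvert :: "'v \<Rightarrow> ('v, 'e) path set" where
  "cvert \<equiv> canonical_vert E K"

abbreviation cedge :: "'e \<Rightarrow> ('v, 'e) path set" where
  "cedge \<equiv> canonical_edge E K"

lemma canonical_diagram: "is_diagram E Q cvert cedge"
proof -
  have "cvert v \<in> Obj Q" if "v \<in> Vert E" for v
    using canonical_vert_in[OF that] that unfolding Obj_def canonical_vert_def
    by (simp add: Dom_quotient path_cat_simps empty_path_def)
  then show ?thesis
    by (simp add: is_diagram_def canonical_edge_in Dom_canonical_edge Cod_canonical_edge)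
qed

lemma relationD:
  assumes "(a, b) \<in> K"
  shows "is_path E a" "is_path E b" "cls a = cls b"
  using parallel[OF assms] cong_class_eqI[OF congruence_closure.base[OF assms]]
  by (simp_all add: path_cat_simps)

lemma Arr_quotientE:
  assumes "X \<in> Arr Q"
  obtains a where "X = cls a" "is_path E a"
  using assms by (auto simp: Arr_quotient path_cat_simps)

lemma cls_eq_path_eval: "is_path E a \<Longrightarrow> cls a = path_eval Q cvert cedge a"
proof (induction rule: path_induct)
  case (Cons e es w)
  then show ?case
    using cls_Cons[of "Rng E e" e es w] by (simp add: path_eval_eq_foldr)
qed (simp add: canonical_vert_def empty_path_def)

lemma functor_cls:
  assumes "is_functor Q D F" "is_path E a"
  shows "F (cls a) = path_eval D (\<lambda>v. F (cvert v)) (\<lambda>e. F (cedge e)) a"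
  using category.functor_path_eval[OF category_quotient canonical_diagram assms]
  by (simp add: cls_eq_path_eval[OF assms(2)])

lemma canonical_satisfies: "satisfies Q cvert cedge K"
proof (rule satisfiesI)
  fix a b assume "(a, b) \<in> K"
  from relationD[OF this] show "path_eval Q cvert cedge a = path_eval Q cvert cedge b"
    by (simp flip: cls_eq_path_eval)
qed

lemma functor_satisfies:
  assumes "is_functor Q D F"
  shows "satisfies D (\<lambda>v. F (cvert v)) (\<lambda>e. F (cedge e)) K"
proof (rule satisfiesI)
  fix a b assume "(a, b) \<in> K"
  from relationD[OF this] show "path_eval D (\<lambda>v. F (cvert v)) (\<lambda>e. F (cedge e)) a =
      path_eval D (\<lambda>v. F (cvert v)) (\<lambda>e. F (cedge e)) b"
    by (simp flip: functor_cls[OF assms])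
qed

lemma cls_append_relation:
  assumes rel: "((v, es, u), (v, es', u)) \<in> K" and path: "is_path E (u, fs, w)"
  shows "cls (v, es @ fs, w) = cls (v, es' @ fs, w)"
proof -
  have "((u, fs, w), (u, fs, w)) \<in> congruence_closure (path_cat E) K"
    using path by (simp add: congruence_closure.refl path_cat_simps)
  then show ?thesis
    using congruence_closure.comp[OF congruence_closure.base[OF rel]]
    by (intro cong_class_eqI) (fastforce simp: path_cat_simps)
qed

definition induced_functor :: "'b cat \<Rightarrow> ('v \<Rightarrow> 'b) \<Rightarrow> ('e \<Rightarrow> 'b) \<Rightarrow> ('v, 'e) path set \<Rightarrow> 'b" where
  "induced_functor D p q = (SOME F. is_functor Q D F \<and>
     (\<forall>v\<in>Vert E. F (cvert v) = p v) \<and> (\<forall>e\<in>Edge E. F (cedge e) = q e))"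

lemma induced_functor:
  assumes "category D" "is_diagram E D p q" "satisfies D p q K"
  shows "is_functor Q D (induced_functor D p q)"
    and "v \<in> Vert E \<Longrightarrow> induced_functor D p q (cvert v) = p v"
    and "e \<in> Edge E \<Longrightarrow> induced_functor D p q (cedge e) = q e"
proof -
  have "\<exists>F. is_functor Q D F \<and> (\<forall>v\<in>Vert E. F (cvert v) = p v) \<and> (\<forall>e\<in>Edge E. F (cedge e) = q e)"
    using functor_exists[OF assms(1)] assms(2) satisfiesD[OF assms(3)]
    by (simp add: is_diagram_def)
  from someI_ex[OF this, folded induced_functor_def]
  show "is_functor Q D (induced_functor D p q)"
    and "v \<in> Vert E \<Longrightarrow> induced_functor D p q (cvert v) = p v"
    and "e \<in> Edge E \<Longrightarrow> induced_functor D p q (cedge e) = q e"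
    by auto
qed

lemma induced_functor_cls:
  assumes "category D" "is_diagram E D p q" "satisfies D p q K" "is_path E a"
  shows "induced_functor D p q (cls a) = path_eval D p q a"
  using functor_cls[OF induced_functor(1)[OF assms(1-3)] assms(4)]
    path_eval_cong[OF assms(4) induced_functor(2,3)[OF assms(1-3)]]
  by simp

end

section \<open>Adjoining formal inverses\<close>

fun positive_path :: "('v, 'e) path \<Rightarrow> ('v, 'e signed) path" where
  "positive_path (v, es, w) = (v, map Pos es, w)"

definition positive_relations ::
  "(('v, 'e) path \<times> ('v, 'e) path) set \<Rightarrow> (('v, 'e signed) path \<times> ('v, 'e signed) path) set" where
  "positive_relations K = map_prod positive_path positive_path ` K"

lemma augmented_simps:
  "Vert (augmented E) = Vert E" "Edge (augmented E) = Pos ` Edge E \<union> Neg ` Edge E"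
  "Rng (augmented E) (Pos e) = Rng E e" "Src (augmented E) (Pos e) = Src E e"
  "Rng (augmented E) (Neg e) = Src E e" "Src (augmented E) (Neg e) = Rng E e"
  by (simp_all add: augmented_def)

lemma is_path_positive: "is_path (augmented E) (positive_path a) \<longleftrightarrow> is_path E a"
  by (induction E a rule: is_path.induct) (auto simp: augmented_simps)

lemma path_eval_positive: "path_eval D p q (positive_path a) = path_eval D p (\<lambda>e. q (Pos e)) a"
  by (induction D p "\<lambda>e. q (Pos e)" a rule: path_eval.induct) auto

lemma satisfies_positive_iff:
  "satisfies D p q (positive_relations K) \<longleftrightarrow> satisfies D p (\<lambda>e. q (Pos e)) K"
  by (simp add: satisfies_def positive_relations_def case_prod_unfold path_eval_positive)

lemma is_diagram_positive: "is_diagram (augmented E) D p q \<Longrightarrow> is_diagram E D p (\<lambda>e. q (Pos e))"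
  by (auto simp: is_diagram_def augmented_simps)

lemma is_diagram_case_signed:
  assumes "is_diagram E D p q" "\<And>e. e \<in> Edge E \<Longrightarrow> inverse_in D (q e) (J e)"
  shows "is_diagram (augmented E) D p (case_signed q J)"
  using assms by (auto simp: is_diagram_def augmented_simps inverse_in_def)

lemma satisfies_cancellation_iff:
  "satisfies D p q (cancellation_relations E) \<longleftrightarrow>
    (\<forall>x\<in>Edge (augmented E). Comp D (q (flip x)) (Comp D (q x) (p (Src (augmented E) x))) =
      p (Src (augmented E) x))"
  unfolding satisfies_def cancellation_relations_def empty_path_def by fastforce

context category
begin

lemma satisfies_cancellation_case_signed:
  assumes diagram: "is_diagram E C p q" and J: "\<And>e. e \<in> Edge E \<Longrightarrow> inverse_in C (q e) (J e)"
  shows "satisfies C p (case_signed q J) (cancellation_relations E)"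
proof -
  have "Comp C (q e) (p (Src E e)) = q e" "Comp C (J e) (p (Rng E e)) = J e" if "e \<in> Edge E" for e
    using J[OF that] is_diagramD(3,4)[OF diagram that] Comp_Dom[of "q e"] Comp_Dom[of "J e"]
    by (auto simp: inverse_in_def)
  then show ?thesis
    using J is_diagramD(3,4)[OF diagram]
    by (auto simp: satisfies_cancellation_iff augmented_simps inverse_in_def)
qed

lemma inverse_in_if_satisfies_cancellation:
  assumes diagram: "is_diagram (augmented E) C p q"
    and cancel: "satisfies C p q (cancellation_relations E)" and e: "e \<in> Edge E"
  shows "inverse_in C (q (Pos e)) (q (Neg e))"
proof -
  have Comp_flip: "Comp C (q (flip x)) (q x) = p (Src (augmented E) x)"
    if "x \<in> Edge (augmented E)" for x
    using cancel Comp_Dom[of "q x"] is_diagramD(2,3)[OF diagram that] that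
    by (auto simp: satisfies_cancellation_iff)
  have "Pos e \<in> Edge (augmented E)" "Neg e \<in> Edge (augmented E)"
    using e by (simp_all add: augmented_simps)
  then show ?thesis
    using Comp_flip[of "Pos e"] Comp_flip[of "Neg e"] is_diagramD(2-4)[OF diagram]
    by (simp add: inverse_in_def augmented_simps)
qed

end

locale formal_inverses = path_relations E K
  for E :: "('v, 'e) graph" and K :: "(('v, 'e) path \<times> ('v, 'e) path) set"

sublocale formal_inverses \<subseteq>
  aug: path_relations "augmented E" "cancellation_relations E \<union> positive_relations K"
proof -
  interpret aug: graph "augmented E" by (rule graph_augmented)
  show "path_relations (augmented E) (cancellation_relations E \<union> positive_relations K)"
  proof
    fix v es w v' es' w'
    assume "((v, es, w), (v', es', w')) \<in> cancellation_relations E \<union> positive_relations K"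
    then consider (cancellation) "((v, es, w), (v', es', w')) \<in> cancellation_relations E"
      | (positive) "((v, es, w), (v', es', w')) \<in> positive_relations K" by blast
    then show "is_path (augmented E) (v, es, w) \<and> is_path (augmented E) (v', es', w') \<and>
      v = v' \<and> w = w'"
    proof cases
      case cancellation
      then show ?thesis
        by (auto simp: cancellation_relations_def empty_path_def augmented_flip aug.Src_closed)
    next
      case positive
      then obtain a b where "(a, b) \<in> K"
        "(v, es, w) = positive_path a" "(v', es', w') = positive_path b"
        by (auto simp: positive_relations_def)
      then show ?thesis
        using is_path_positive[of E a] is_path_positive[of E b] path_parallel
        by (cases a; cases b) auto
    qed
  qed
qed

context formal_inverses
begin

lemma category_aug: "category aug.Q"
  by (rule aug.category_quotient)

lemma aug_satisfies:
  "satisfies aug.Q aug.cvert aug.cedge (cancellation_relations E)"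
  "satisfies aug.Q aug.cvert (\<lambda>e. aug.cedge (Pos e)) K"
  using aug.canonical_satisfies by (simp_all add: satisfies_Un satisfies_positive_iff)

lemma inverse_in_cedge: "e \<in> Edge E \<Longrightarrow> inverse_in aug.Q (aug.cedge (Pos e)) (aug.cedge (Neg e))"
  by (rule category.inverse_in_if_satisfies_cancellation
      [OF category_aug aug.canonical_diagram aug_satisfies(1)])

definition localization :: "('v, 'e) path set \<Rightarrow> ('v, 'e signed) path set" where
  "localization = induced_functor aug.Q aug.cvert (\<lambda>e. aug.cedge (Pos e))"

lemma
  shows is_functor_localization: "is_functor Q aug.Q localization"
    and localization_cvert: "v \<in> Vert E \<Longrightarrow> localization (cvert v) = aug.cvert v"
    and localization_cedge: "e \<in> Edge E \<Longrightarrow> localization (cedge e) = aug.cedge (Pos e)"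
  using induced_functor
    [OF category_aug is_diagram_positive[OF aug.canonical_diagram] aug_satisfies(2)]
  by (simp_all add: localization_def)

lemma localization_cls:
  "is_path E a \<Longrightarrow> localization (cls a) = path_eval aug.Q aug.cvert (\<lambda>e. aug.cedge (Pos e)) a"
  unfolding localization_def
  by (rule induced_functor_cls
      [OF category_aug is_diagram_positive[OF aug.canonical_diagram] aug_satisfies(2)])

lemma invertible_localization:
  assumes "X \<in> Arr Q"
  shows "invertible_in aug.Q (localization X)"
proof -
  obtain a where X: "X = cls a" "is_path E a" by (rule Arr_quotientE[OF assms])
  have "invertible_in aug.Q (aug.cedge (Pos e))" if "e \<in> Edge E" for e
    using inverse_in_cedge[OF that] by (auto simp: invertible_in_iff)
  then show ?thesis
    using category.invertible_path_eval
      [OF category_aug is_diagram_positive[OF aug.canonical_diagram] _ X(2)]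
    by (simp add: X(1) localization_cls[OF X(2)])
qed

lemma localization_extension_exists:
  assumes D: "category D" and F: "is_functor Q D F"
    and inv: "\<And>X. X \<in> Arr Q \<Longrightarrow> invertible_in D (F X)"
  shows "\<exists>F'. is_functor aug.Q D F' \<and> (\<forall>X\<in>Arr Q. F' (localization X) = F X)"
proof -
  interpret Q: category Q by (rule category_quotient)
  let ?p = "\<lambda>v. F (cvert v)" and ?q = "\<lambda>e. F (cedge e)"
  obtain J where J: "\<And>e. e \<in> Edge E \<Longrightarrow> inverse_in D (?q e) (J e)"
    using inv[OF canonical_edge_in] unfolding invertible_in_iff by metis
  have diagram: "is_diagram E D ?p ?q" by (rule is_diagram_functor[OF F canonical_diagram])
  have "satisfies D ?p (case_signed ?q J) (cancellation_relations E \<union> positive_relations K)"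
    using category.satisfies_cancellation_case_signed[OF D diagram J] functor_satisfies[OF F]
    by (simp add: satisfies_Un satisfies_positive_iff)
  note F' = aug.induced_functor[OF D is_diagram_case_signed[OF diagram J] this]
  let ?F' = "aug.induced_functor D ?p (case_signed ?q J)"
  have compose_F': "compose (Arr Q) ?F' localization = F"
    by (rule functor_eqI[OF Q.is_functor_compose[OF is_functor_localization F'(1)] F])
      (simp_all add: compose_eq canonical_vert_in canonical_edge_in localization_cvert
        localization_cedge F' augmented_simps)
  have "?F' (localization X) = F X" if "X \<in> Arr Q" for X
    using fun_cong[OF compose_F', of X] that by (simp add: compose_eq)
  then show ?thesis using F'(1) by blast
qed

lemma localization_extension_unique:
  assumes D: "category D" and F1: "is_functor aug.Q D F1" and F2: "is_functor aug.Q D F2"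
    and eq: "\<And>X. X \<in> Arr Q \<Longrightarrow> F1 (localization X) = F2 (localization X)"
  shows "F1 = F2"
proof (rule aug.functor_eqI[OF F1 F2])
  show "F1 (aug.cvert v) = F2 (aug.cvert v)" if "v \<in> Vert (augmented E)" for v
    using eq[OF canonical_vert_in, of v] that
    by (simp add: localization_cvert augmented_simps)
  have Pos: "F1 (aug.cedge (Pos e)) = F2 (aug.cedge (Pos e))" if "e \<in> Edge E" for e
    using eq[OF canonical_edge_in, of e] that by (simp add: localization_cedge)
  have Neg: "F1 (aug.cedge (Neg e)) = F2 (aug.cedge (Neg e))" if "e \<in> Edge E" for e
    using category.inverse_in_unique[OF D] Pos[OF that]
      inverse_in_functor[OF F1 inverse_in_cedge[OF that]]
      inverse_in_functor[OF F2 inverse_in_cedge[OF that]] by metis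
  show "F1 (aug.cedge x) = F2 (aug.cedge x)" if "x \<in> Edge (augmented E)" for x
    using that Pos Neg by (auto simp: augmented_simps)
qed

theorem is_fundamental_groupoid_localization:
  "is_fundamental_groupoid TYPE('x) Q aug.Q localization"
  unfolding is_fundamental_groupoid_def
proof (intro conjI allI impI ballI; (elim conjE)?)
  fix D :: "'x cat" and F
  assume D: "category D" and F: "is_functor Q D F" and "\<forall>X\<in>Arr Q. invertible_in D (F X)"
  then have "\<exists>F'. is_functor aug.Q D F' \<and> (\<forall>X\<in>Arr Q. F' (localization X) = F X)"
    by (intro localization_extension_exists) auto
  then show "\<exists>!F'. is_functor aug.Q D F' \<and> (\<forall>X\<in>Arr Q. F' (localization X) = F X)"
    using localization_extension_unique[OF D] by (intro ex_ex1I) auto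
qed (use category_aug is_functor_localization invertible_localization in auto)

end

section \<open>Presentation of a k-graph by edges and commuting squares\<close>

definition skeleton_squares ::
  "nat \<Rightarrow> 'a cat \<Rightarrow> ('a \<Rightarrow> nat \<Rightarrow> nat) \<Rightarrow> (('a, 'a) path \<times> ('a, 'a) path) set" where
  "skeleton_squares k L d =
     {((Cod L e, [e, f], Dom L f), (Cod L g, [g, h], Dom L h)) | e f g h.
        {e, f, g, h} \<subseteq> Edge (skeleton k L d) \<and> Dom L e = Cod L f \<and> d e \<noteq> d f \<and>
        Dom L g = Cod L h \<and> Comp L e f = Comp L g h \<and> d g = d f \<and> d h = d e}"

lemma commuting_squares_eq: "commuting_squares k L d = positive_relations (skeleton_squares k L d)"
  unfolding commuting_squares_def positive_relations_def skeleton_squares_def by force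

context k_graph
begin

abbreviation Sk :: "('a, 'a) graph" where
  "Sk \<equiv> skeleton k L d"

abbreviation squares :: "(('a, 'a) path \<times> ('a, 'a) path) set" where
  "squares \<equiv> skeleton_squares k L d"

abbreviation composite :: "('a, 'a) path \<Rightarrow> 'a" where
  "composite \<equiv> path_eval L id id"

lemma skeleton_simps [simp]:
  "Vert Sk = Obj L" "Rng Sk = Cod L" "Src Sk = Dom L"
  by (simp_all add: skeleton_def)

lemma Edge_skeleton_iff: "e \<in> Edge Sk \<longleftrightarrow> e \<in> Arr L \<and> (\<exists>i<k. d e = unit_deg i)"
  by (auto simp: skeleton_def)

lemma edge_in_Arr: "e \<in> Edge Sk \<Longrightarrow> e \<in> Arr L"
  by (simp add: Edge_skeleton_iff)

lemma edge_if_deg_eq: "\<lbrakk>e \<in> Arr L; d e = d f; f \<in> Edge Sk\<rbrakk> \<Longrightarrow> e \<in> Edge Sk"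
  by (simp add: Edge_skeleton_iff)

lemma graph_skeleton: "graph Sk"
  by unfold_locales (auto simp: Dom_Cod_in_Obj edge_in_Arr)

lemma skeleton_diagram: "is_diagram Sk L id id"
  by (simp add: is_diagram_def edge_in_Arr)

lemma skeleton_satisfies_squares: "satisfies L id id squares"
proof -
  have "Comp L e (Comp L f (Dom L f)) = Comp L e f" if "f \<in> Edge Sk" for e f
    using that by (simp add: Comp_Dom edge_in_Arr)
  then show ?thesis by (auto simp: satisfies_def skeleton_squares_def)
qed

lemma factorization_unique:
  assumes bc: "b \<in> Arr L" "c \<in> Arr L" "Dom L b = Cod L c"
    and bc': "b' \<in> Arr L" "c' \<in> Arr L" "Dom L b' = Cod L c'"
    and eq: "Comp L b c = Comp L b' c'" and deg: "d b = d b'"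
  shows "b = b'" "c = c'"
proof -
  have deg': "d c = d c'" using deg_Comp[OF bc] deg_Comp[OF bc'] eq deg by simp
  have "\<exists>!(x, y)\<in>Arr L \<times> Arr L. d x = d b \<and> d y = d c \<and> Dom L x = Cod L y \<and> Comp L b c = Comp L x y"
    using factorization[OF Comp_closed deg_Nk deg_Nk deg_Comp] bc by blast
  then have "(b, c) = (b', c')"
    by (rule ex1E) (use assms deg' in \<open>auto dest!: spec\<close>)
  then show "b = b'" "c = c'" by simp_all
qed

lemma factorization_exists:
  assumes "a \<in> Arr L" "n \<in> Nk k" "l \<in> Nk k" "d a = n + l"
  obtains b c where "b \<in> Arr L" "c \<in> Arr L" "d b = n" "d c = l" "Dom L b = Cod L c" "a = Comp L b c"
  using ex1_implies_ex[OF factorization[OF assms]] by (elim exE case_prodE) (use that in force)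

lemma edge_factor_exists:
  assumes a: "a \<in> Arr L" and i: "d a i > 0"
  obtains e b where "e \<in> Edge Sk" "d e = unit_deg i" "b \<in> Arr L" "Dom L e = Cod L b"
    "a = Comp L e b"
proof -
  define l where "l = (\<lambda>j. if j = i then d a j - 1 else d a j)"
  have ik: "i < k" using deg_Nk[OF a] i by (force simp: Nk_def not_less[symmetric])
  have "unit_deg i \<in> Nk k" "l \<in> Nk k" "d a = unit_deg i + l"
    using ik i deg_Nk[OF a] by (auto simp: Nk_def l_def unit_deg_def fun_eq_iff)
  then obtain e b where "e \<in> Arr L" "b \<in> Arr L" "d e = unit_deg i" "Dom L e = Cod L b"
    "a = Comp L e b"
    by (rule factorization_exists[OF a])
  then show ?thesis using ik by (intro that[of e b]) (auto simp: Edge_skeleton_iff)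
qed

lemma Obj_iff_deg_0:
  assumes a: "a \<in> Arr L"
  shows "a \<in> Obj L \<longleftrightarrow> d a = 0"
proof
  assume "d a = 0"
  then have "a = Cod L a"
    using factorization_unique(1)[of a "Dom L a" "Cod L a" a] a deg_Obj[OF Dom_Cod_in_Obj(2)[OF a]]
    by (simp add: Dom_closed Cod_closed Cod_Dom Dom_Cod Comp_Dom Comp_Cod)
  then show "a \<in> Obj L" using Dom_Cod_in_Obj(2)[OF a] by simp
qed (rule deg_Obj)

definition total_deg :: "'a \<Rightarrow> nat" where
  "total_deg a = (\<Sum>i<k. d a i)"

lemma total_deg_edge_Comp:
  assumes "e \<in> Edge Sk" "a \<in> Arr L" "Dom L e = Cod L a"
  shows "total_deg (Comp L e a) = Suc (total_deg a)"
  using assms by (auto simp: total_deg_def deg_Comp sum.distrib unit_deg_def Edge_skeleton_iff)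

lemma composite_closed:
  assumes "is_path Sk (v, es, w)"
  shows "composite (v, es, w) \<in> Arr L" "Dom L (composite (v, es, w)) = w"
    "Cod L (composite (v, es, w)) = v"
  using path_eval_closed[OF skeleton_diagram assms] by simp_all

lemma total_deg_composite: "is_path Sk (v, es, w) \<Longrightarrow> total_deg (composite (v, es, w)) = length es"
proof (induction "(v, es, w)" arbitrary: v es w rule: path_induct)
  case (empty v)
  then show ?case using deg_Obj[of v] by (simp add: total_deg_def)
next
  case (Cons e es w)
  then show ?case
    using composite_closed[OF Cons.hyps(2)]
    by (simp add: path_eval_eq_foldr total_deg_edge_Comp)
qed

lemma length_eq_if_composite_eq:
  "\<lbrakk>is_path Sk (v, es, w); is_path Sk (v', fs, w'); composite (v, es, w) = composite (v', fs, w')\<rbrakk>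
    \<Longrightarrow> length es = length fs"
  by (metis total_deg_composite)

lemma edge_path_exists:
  assumes "a \<in> Arr L"
  obtains es where "is_path Sk (Cod L a, es, Dom L a)" "composite (Cod L a, es, Dom L a) = a"
proof -
  have "\<exists>es. is_path Sk (Cod L a, es, Dom L a) \<and> composite (Cod L a, es, Dom L a) = a"
    using assms
  proof (induction "total_deg a" arbitrary: a rule: less_induct)
    case less
    show ?case
    proof (cases "a \<in> Obj L")
      case True
      then show ?thesis by (intro exI[of _ "[]"]) (simp add: Obj_simps)
    next
      case False
      then obtain i where "d a i > 0" using less.prems by (auto simp: Obj_iff_deg_0 fun_eq_iff)
      then obtain e b where e: "e \<in> Edge Sk" and b: "b \<in> Arr L" "Dom L e = Cod L b" "a = Comp L e b"
        by (rule edge_factor_exists[OF less.prems])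
      obtain es where "is_path Sk (Cod L b, es, Dom L b)" "composite (Cod L b, es, Dom L b) = b"
        using less.hyps[of b] b total_deg_edge_Comp[OF e b(1,2)] by auto
      then show ?thesis
        using e b edge_in_Arr[OF e]
        by (intro exI[of _ "e # es"]) (simp add: path_eval_eq_foldr Dom_Comp Cod_Comp)
    qed
  qed
  then show ?thesis using that by blast
qed

lemma functor_eq_on_skeleton_iff:
  assumes F: "is_functor L D F" and F': "is_functor L D F'"
  shows "(\<forall>a\<in>Arr L. F a = F' a) \<longleftrightarrow> (\<forall>v\<in>Obj L. F v = F' v) \<and> (\<forall>e\<in>Edge Sk. F e = F' e)"
proof
  assume eq: "(\<forall>v\<in>Obj L. F v = F' v) \<and> (\<forall>e\<in>Edge Sk. F e = F' e)"
  show "\<forall>a\<in>Arr L. F a = F' a"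
  proof
    fix a assume "a \<in> Arr L"
    then obtain es where path: "is_path Sk (Cod L a, es, Dom L a)"
      and a: "composite (Cod L a, es, Dom L a) = a"
      by (rule edge_path_exists)
    show "F a = F' a"
      using path_eval_cong[OF path, of F F' F F' D] eq
        functor_path_eval[OF skeleton_diagram F path] functor_path_eval[OF skeleton_diagram F' path]
      by (simp add: a)
  qed
qed (simp add: Obj_simps edge_in_Arr)

lemma square_exists:
  assumes e: "e \<in> Edge Sk" and g: "g \<in> Edge Sk" and eg: "Dom L e = Cod L g" and deg: "d e \<noteq> d g"
  obtains f h where "f \<in> Arr L" "h \<in> Arr L" "d f = d g" "Dom L f = Cod L h" "Dom L h = Dom L g"
    "Comp L e g = Comp L f h" "((Cod L e, [e, g], Dom L g), (Cod L e, [f, h], Dom L g)) \<in> squares"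
proof -
  note eA = edge_in_Arr[OF e] and gA = edge_in_Arr[OF g]
  have "d (Comp L e g) = d g + d e" using deg_Comp[OF eA gA eg] by (simp add: add.commute)
  then obtain f h where f: "f \<in> Arr L" "d f = d g" and h: "h \<in> Arr L" "d h = d e"
    and fh: "Dom L f = Cod L h" "Comp L e g = Comp L f h"
    by (rule factorization_exists[OF Comp_closed[OF eA gA eg] deg_Nk[OF gA] deg_Nk[OF eA]])
  have ends: "Cod L f = Cod L e" "Dom L h = Dom L g"
    using Cod_Comp[OF eA gA eg] Cod_Comp[OF f(1) h(1) fh(1)]
      Dom_Comp[OF eA gA eg] Dom_Comp[OF f(1) h(1) fh(1)] fh(2) by simp_all
  have "{e, g, f, h} \<subseteq> Edge Sk"
    using e g edge_if_deg_eq[OF f g] edge_if_deg_eq[OF h e] by simp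
  then have "((Cod L e, [e, g], Dom L g), (Cod L e, [f, h], Dom L g)) \<in> squares"
    using eg deg fh f(2) h(2) ends unfolding skeleton_squares_def by force
  then show ?thesis using that f h fh ends(2) by blast
qed

text \<open>
  Factor \<open>b = g m\<close> with \<open>d g = d f\<close>, and let \<open>e g = f' h\<close> be the square on \<open>e g\<close>. Then
  \<open>f c = f' (h m)\<close> with \<open>d f' = d f\<close>, so \<open>f' = f\<close> and \<open>c = h m\<close>.
\<close>

lemma edge_factors_complete_square:
  assumes e: "e \<in> Edge Sk" and b: "b \<in> Arr L" "Dom L e = Cod L b"
    and f: "f \<in> Edge Sk" and c: "c \<in> Arr L" "Dom L f = Cod L c"
    and eq: "Comp L e b = Comp L f c" and deg: "d e \<noteq> d f"
  obtains g h m where "m \<in> Arr L" "Dom L g = Cod L m" "b = Comp L g m" "c = Comp L h m"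
    "((Cod L e, [e, g], Cod L m), (Cod L e, [f, h], Cod L m)) \<in> squares"
proof -
  note eA = edge_in_Arr[OF e] and fA = edge_in_Arr[OF f]
  obtain i j where i: "d e = unit_deg i" and j: "d f = unit_deg j"
    using e f by (auto simp: Edge_skeleton_iff)
  have "d e + d b = d f + d c" using eq eA fA b c by (simp flip: deg_Comp)
  then have "d e j + d b j = d f j + d c j" by (simp add: fun_eq_iff)
  then have "d b j > 0" using deg i j by (auto simp: unit_deg_def split: if_splits)
  then obtain g m where g: "g \<in> Edge Sk" "d g = unit_deg j" and m: "m \<in> Arr L" "Dom L g = Cod L m"
    and b_eq: "b = Comp L g m"
    by (rule edge_factor_exists[OF b(1)])
  note gA = edge_in_Arr[OF g(1)]
  have eg: "Dom L e = Cod L g" using b(2) b_eq gA m by (simp add: Cod_Comp)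
  obtain f' h where f': "f' \<in> Arr L" "d f' = d g" and h: "h \<in> Arr L" "Dom L h = Dom L g"
    and f'h: "Dom L f' = Cod L h" "Comp L e g = Comp L f' h"
    and square: "((Cod L e, [e, g], Dom L g), (Cod L e, [f', h], Dom L g)) \<in> squares"
    using square_exists[OF e g(1) eg] deg g(2) j by metis
  have "Comp L f c = Comp L (Comp L e g) m" using eq b_eq eA gA eg m by (simp add: Comp_assoc)
  also have "\<dots> = Comp L f' (Comp L h m)" using f' h f'h m by (simp add: Comp_assoc)
  finally have fc: "Comp L f c = Comp L f' (Comp L h m)" .
  have "f = f'" "c = Comp L h m"
    by (rule factorization_unique[OF fA c _ _ _ fc];
        use f' h f'h m g(2) j in \<open>simp add: Comp_closed Cod_Comp\<close>)+
  then show ?thesis using that m b_eq square by simp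
qed

lemma path_relations_squares: "path_relations Sk squares"
proof -
  interpret graph Sk by (rule graph_skeleton)
  show ?thesis
  proof
    fix v es w v' es' w' assume "((v, es, w), (v', es', w')) \<in> squares"
    then obtain e f g h where es: "es = [e, f]" "v = Cod L e" "w = Dom L f"
      and es': "es' = [g, h]" "v' = Cod L g" "w' = Dom L h"
      and edges: "{e, f, g, h} \<subseteq> Edge Sk"
      and square: "Dom L e = Cod L f" "Dom L g = Cod L h" "Comp L e f = Comp L g h"
      unfolding skeleton_squares_def by blast
    have "Cod L e = Cod L g" "Dom L f = Dom L h"
      using Cod_Comp[of e f] Cod_Comp[of g h] Dom_Comp[of e f] Dom_Comp[of g h] edges square
      by (simp_all add: edge_in_Arr)
    then show "is_path Sk (v, es, w) \<and> is_path Sk (v', es', w') \<and> v = v' \<and> w = w'"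
      using edges square(1,2) by (simp add: es es' Dom_Cod_in_Obj edge_in_Arr)
  qed
qed

end

sublocale k_graph \<subseteq> P: formal_inverses Sk squares
  by (rule formal_inverses.intro) (rule path_relations_squares)

context k_graph
begin

lemma edge_factors_congruent_paths:
  assumes e: "e \<in> Edge Sk" and b: "b \<in> Arr L" "Dom L e = Cod L b"
    and f: "f \<in> Edge Sk" and c: "c \<in> Arr L" "Dom L f = Cod L c"
    and eq: "Comp L e b = Comp L f c"
  obtains es fs where "is_path Sk (Dom L e, es, Dom L b)" "composite (Dom L e, es, Dom L b) = b"
    "is_path Sk (Dom L f, fs, Dom L b)" "composite (Dom L f, fs, Dom L b) = c"
    "P.cls (Cod L e, e # es, Dom L b) = P.cls (Cod L e, f # fs, Dom L b)"
proof (cases "d e = d f")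
  case True
  have "e = f" "b = c"
    by (rule factorization_unique[OF edge_in_Arr[OF e] b edge_in_Arr[OF f] c eq True])+
  then show ?thesis using edge_path_exists[OF b(1)] b(2) that by metis
next
  case False
  obtain g h m where m: "m \<in> Arr L" "Dom L g = Cod L m" "b = Comp L g m" "c = Comp L h m"
    and square: "((Cod L e, [e, g], Cod L m), (Cod L e, [f, h], Cod L m)) \<in> squares"
    by (rule edge_factors_complete_square[OF assms False])
  obtain ms where ms: "is_path Sk (Cod L m, ms, Dom L m)" "composite (Cod L m, ms, Dom L m) = m"
    by (rule edge_path_exists[OF m(1)])
  have eg: "is_path Sk (Cod L e, [e, g], Cod L m)" and fh: "is_path Sk (Cod L e, [f, h], Cod L m)"
    using P.path_parallel[OF square] by blast+
  have "Dom L b = Dom L m" using m eg by (simp add: Dom_Comp edge_in_Arr)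
  then show ?thesis
    using that[of "g # ms" "h # ms"] eg fh m(3,4) ms P.cls_append_relation[OF square ms(1)]
    by (simp add: path_eval_eq_foldr)
qed

lemma cls_eq_if_composite_eq:
  assumes "is_path Sk (v, es, w)" "is_path Sk (v, fs, w)"
    and "composite (v, es, w) = composite (v, fs, w)"
  shows "P.cls (v, es, w) = P.cls (v, fs, w)"
  using assms
proof (induction "length es" arbitrary: v es fs)
  case 0
  then show ?case using length_eq_if_composite_eq[OF "0.prems"] by simp
next
  case (Suc n)
  then obtain e es' f fs' where es: "es = e # es'" and fs: "fs = f # fs'"
    using length_eq_if_composite_eq[OF Suc.prems] by (metis length_Suc_conv)
  have e: "e \<in> Edge Sk" "Cod L e = v" and es': "is_path Sk (Dom L e, es', w)"
    and f: "f \<in> Edge Sk" "Cod L f = v" and fs': "is_path Sk (Dom L f, fs', w)"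
    using Suc.prems(1,2) by (simp_all add: es fs)
  note b = composite_closed[OF es'] and c = composite_closed[OF fs']
  have "Comp L e (composite (Dom L e, es', w)) = Comp L f (composite (Dom L f, fs', w))"
    using Suc.prems(3) by (simp add: es fs path_eval_eq_foldr)
  then obtain gs hs where gs: "is_path Sk (Dom L e, gs, w)"
      "composite (Dom L e, gs, w) = composite (Dom L e, es', w)"
    and hs: "is_path Sk (Dom L f, hs, w)"
      "composite (Dom L f, hs, w) = composite (Dom L f, fs', w)"
    and cls_gs_hs: "P.cls (v, e # gs, w) = P.cls (v, f # hs, w)"
    using edge_factors_congruent_paths[OF e(1) b(1) _ f(1) c(1)] b c e(2) by metis
  have lengths: "n = length es'" "n = length hs"
    using Suc.hyps(2) length_eq_if_composite_eq[OF Suc.prems]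
      length_eq_if_composite_eq[OF hs(1) fs' hs(2)]
    by (simp_all add: es fs)
  have "P.cls (Dom L e, es', w) = P.cls (Dom L e, gs, w)"
    by (rule Suc.hyps(1)[OF lengths(1) es' gs(1) gs(2)[symmetric]])
  moreover have "P.cls (Dom L f, hs, w) = P.cls (Dom L f, fs', w)"
    by (rule Suc.hyps(1)[OF lengths(2) hs(1) fs' hs(2)])
  ultimately show ?case
    using P.cls_Cons[of v e es' w] P.cls_Cons[of v e gs w] P.cls_Cons[of v f hs w]
      P.cls_Cons[of v f fs' w] e f es' fs' gs(1) hs(1) cls_gs_hs
    by (simp add: es fs)
qed

lemma bij_betw_induced_functor: "bij_betw (P.induced_functor L id id) (Arr P.Q) (Arr L)"
proof -
  let ?T = "P.induced_functor L id id"
  note skeleton = category_axioms skeleton_diagram skeleton_satisfies_squares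
  note T_cls = P.induced_functor_cls[OF skeleton]
  have "inj_on ?T (Arr P.Q)"
  proof (rule inj_onI)
    fix X Y assume "X \<in> Arr P.Q" "Y \<in> Arr P.Q" and eq: "?T X = ?T Y"
    then obtain v es w v' fs w' where X: "X = P.cls (v, es, w)" "is_path Sk (v, es, w)"
      and Y: "Y = P.cls (v', fs, w')" "is_path Sk (v', fs, w')"
      by (metis P.Arr_quotientE prod_cases3)
    have "composite (v, es, w) = composite (v', fs, w')"
      using eq by (simp add: X Y T_cls)
    then show "X = Y"
      using composite_closed[OF X(2)] composite_closed[OF Y(2)] X Y cls_eq_if_composite_eq by metis
  qed
  moreover have "Arr L \<subseteq> ?T ` Arr P.Q"
  proof
    fix a assume "a \<in> Arr L"
    then obtain es where "is_path Sk (Cod L a, es, Dom L a)" "composite (Cod L a, es, Dom L a) = a"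
      by (rule edge_path_exists)
    then show "a \<in> ?T ` Arr P.Q"
      by (intro image_eqI[of _ _ "P.cls (Cod L a, es, Dom L a)"])
        (simp_all add: T_cls P.Arr_quotient path_cat_simps)
  qed
  ultimately show ?thesis
    using is_functorD(1)[OF P.induced_functor(1)[OF skeleton]] by (auto simp: bij_betw_def)
qed

theorem k_graph_presentation:
  obtains \<Phi> where "is_isomorphism L P.Q \<Phi>" "\<And>v. v \<in> Obj L \<Longrightarrow> \<Phi> v = P.cvert v"
    "\<And>e. e \<in> Edge Sk \<Longrightarrow> \<Phi> e = P.cedge e"
proof -
  note T = P.induced_functor[OF category_axioms skeleton_diagram skeleton_satisfies_squares]
  have "is_isomorphism P.Q L (P.induced_functor L id id)"
    by (rule category.is_isomorphism_if_bij_betw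
        [OF P.category_quotient category_axioms T(1) bij_betw_induced_functor])
  from ex_inverse_isomorphism[OF this] obtain \<Phi> where \<Phi>: "is_isomorphism L P.Q \<Phi>"
    "\<forall>X\<in>Arr P.Q. \<Phi> (P.induced_functor L id id X) = X"
    by (elim exE conjE) (rule that)
  have "\<Phi> v = P.cvert v" if "v \<in> Obj L" for v
    using \<Phi>(2)[rule_format, OF P.canonical_vert_in] T(2) that by simp
  moreover have "\<Phi> e = P.cedge e" if "e \<in> Edge Sk" for e
    using \<Phi>(2)[rule_format, OF P.canonical_edge_in] T(3) that by simp
  ultimately show ?thesis by (rule that[OF \<Phi>(1)])
qed

end

theorem theorem5p5:
  fixes L :: "'a cat" and d :: "'a \<Rightarrow> nat \<Rightarrow> nat" and k :: nat
    and G :: "'g cat" and i :: "'a \<Rightarrow> 'g"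
    and E :: "('a, 'a) graph" and S C :: "(('a, 'a signed) path \<times> ('a, 'a signed) path) set"
  assumes "k_graph L k d"
    and "E = skeleton k L d"
    and "S = commuting_squares k L d"
    and "C = cancellation_relations E"
    and "is_fundamental_groupoid TYPE('g) L G i"
    and "is_fundamental_groupoid TYPE(('a, 'a signed) path set) L G i"
  shows "\<exists>!T. is_isomorphism G (path_cat_mod (augmented E) (C \<union> S)) T \<and>
      (\<forall>v\<in>Vert E. T (i v) = canonical_vert (augmented E) (C \<union> S) v) \<and>
      (\<forall>e\<in>Edge E. T (i e) = canonical_edge (augmented E) (C \<union> S) (Pos e))"
proof -
  interpret k_graph L k d by fact
  obtain \<Phi> where \<Phi>: "is_isomorphism L P.Q \<Phi>" "\<And>v. v \<in> Obj L \<Longrightarrow> \<Phi> v = P.cvert v"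
    "\<And>e. e \<in> Edge Sk \<Longrightarrow> \<Phi> e = P.cedge e"
    using k_graph_presentation by blast
  let ?j = "compose (Arr L) P.localization \<Phi>"
  note j = is_fundamental_groupoid_compose_isomorphism
    [OF P.is_fundamental_groupoid_localization P.category_quotient \<Phi>(1)]
  have "(\<forall>a\<in>Arr L. T (i a) = ?j a) \<longleftrightarrow>
      (\<forall>v\<in>Obj L. T (i v) = P.aug.cvert v) \<and> (\<forall>e\<in>Edge Sk. T (i e) = P.aug.cedge (Pos e))"
    if "is_isomorphism G P.aug.Q T" for T
  proof -
    have "is_functor L P.aug.Q (compose (Arr L) T i)"
      using is_functor_compose is_fundamental_groupoidD(2)[OF assms(5)] that
      by (auto simp: is_isomorphism_def)
    from functor_eq_on_skeleton_iff[OF this is_fundamental_groupoidD(2)[OF j]]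
    show ?thesis
      by (simp add: compose_eq Obj_simps edge_in_Arr \<Phi> P.localization_cvert P.localization_cedge)
  qed
  moreover have "\<exists>!T. is_isomorphism G P.aug.Q T \<and> (\<forall>a\<in>Arr L. T (i a) = ?j a)"
    by (rule fundamental_groupoid_unique[OF assms(5,6) j j])
  ultimately show ?thesis
    unfolding assms(2-4) commuting_squares_eq skeleton_simps(1) by (simp cong: conj_cong)
qed

end
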